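(* Let $[B_1\mid A_{11}]$ be a core problem over $\mathbb{C}$. Then its irreducible reduced structure is unique up to unitary transformations and permutation of the irreducible component subproblems. That is: if $$[B^{(1)}\mid A^{(1)}],\dots,[B^{(g)}\mid A^{(g)}]\quad\text{and}\quad [\tilde B^{(1)}\mid \tilde A^{(1)}],\dots,[\tilde B^{(\tilde g)}\mid \tilde A^{(\tilde g)}]$$ are the components of two irreducible reduced structures of $[B_1\mid A_{11}]$, then $g=\tilde g$ and there exist a permutation $\pi$ of $\{1,\dots,g\}$ and, for each $t$, unitary matrices $P_t,Q_t,R_t$ such that $$P_t^*\,[B^{(t)}\mid A^{(t)}]\begin{bmatrix}R_t&0\\0&Q_t\end{bmatrix}=[\tilde B^{(\pi(t))}\mid \tilde A^{(\pi(t))}].$$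
   Context: All matrices are complex. Core problem. Consider an approximation problem $AX\approx B$ with $A\in\mathbb{C}^{m\times n}$, $B\in\mathbb{C}^{m\times d}$, $A^*B\ne 0$ and $\mathcal R(B)\not\subset\mathcal R(A)$. Among all unitary $P,Q,R$ with $$P^*[BR\mid AQ]=\left[\begin{array}{cc|cc}B_1&0&A_{11}&0\\0&0&0&A_{22}\end{array}\right],$$ choose ones for which the block $[B_1\mid A_{11}]$ has minimal dimension and $A_{22}$ has maximal dimension. The subproblem $A_{11}X_{11}\approx B_1$, also written $[B_1\mid A_{11}]$, is called the core problem. Reduced structure. A reduced structure of $[B_1\mid A_{11}]$ consists of unitary $P,Q,R$ such that $$P^*[B_1\mid A_{11}]\begin{bmatrix}R&0\\0&Q\end{bmatrix}=\left[\,\mathrm{diag}(B^{(1)},\dots,B^{(g)})\;\middle|\;\mathrm{diag}(A^{(1)},\dots,A^{(g)})\,\right],$$ where some blocks $A^{(t)}$ are allowed to have no columns. The subproblems $[B^{(t)}\mid A^{(t)}]$ are called its components. A core problem is reducible if it has such a structure with $g\ge 2$ (nonempty) components, and irreducible otherwise. A reduced structure is irreducible if each of its components $[B^{(t)}\mid A^{(t)}]$ is an irreducible core problem (the trivial structure $g=1$ is allowed when the core problem itself is irreducible). *)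

theory Defs
  imports "Jordan_Normal_Form.Schur_Decomposition" "Jordan_Normal_Form.VS_Connect"
    "HOL-Combinatorics.Permutations"
begin

text \<open>
  An extended matrix \<open>[B | A]\<close> is given by the pair of its two blocks, so that the position of the
  bar is part of the data. As \<open>[B | A] diag(R, Q) = [B R | A Q]\<close>, the equation
  \<open>P\<^sup>* [B | A] diag(R, Q) = [B' | A']\<close> amounts to \<open>P\<^sup>* B R = B'\<close> and \<open>P\<^sup>* A Q = A'\<close>.
  Matrices may have zero rows or columns.
\<close>

definition unitary_mat :: "nat \<Rightarrow> complex mat \<Rightarrow> bool" where
  "unitary_mat k U \<longleftrightarrow>
     U \<in> carrier_mat k k \<and> mat_adjoint U * U = 1\<^sub>m k \<and> U * mat_adjoint U = 1\<^sub>m k"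

text \<open>
  The block form \<open>P\<^sup>* [B R | A Q] = [B1 0 | A11 0; 0 0 | 0 A22]\<close>. Equality of matrices includes
  equality of their sizes, so \<open>dim_row A = dim_row A11 + dim_row A22\<close>, and likewise for the columns.
\<close>

definition core_form ::
  "complex mat \<Rightarrow> complex mat \<Rightarrow> complex mat \<Rightarrow> complex mat \<Rightarrow> complex mat \<Rightarrow>
   complex mat \<Rightarrow> complex mat \<Rightarrow> complex mat \<Rightarrow> bool" where
  "core_form B A P Q R B1 A11 A22 \<longleftrightarrow>
     dim_row B = dim_row A \<and> dim_row B1 = dim_row A11 \<and>
     unitary_mat (dim_row A) P \<and> unitary_mat (dim_col A) Q \<and> unitary_mat (dim_col B) R \<and>
     dim_col B1 \<le> dim_col B \<and>
     mat_adjoint P * B * R =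
       four_block_mat B1 (0\<^sub>m (dim_row B1) (dim_col B - dim_col B1))
         (0\<^sub>m (dim_row A22) (dim_col B1)) (0\<^sub>m (dim_row A22) (dim_col B - dim_col B1)) \<and>
     mat_adjoint P * A * Q =
       four_block_mat A11 (0\<^sub>m (dim_row A11) (dim_col A22))
         (0\<^sub>m (dim_row A22) (dim_col A11)) A22"

text \<open>
  Minimality of \<open>[B1 | A11]\<close> and maximality of \<open>A22\<close> are meant in every dimension simultaneously.
\<close>

definition core_subproblem_of ::
  "complex mat \<Rightarrow> complex mat \<Rightarrow> complex mat \<Rightarrow> complex mat \<Rightarrow> bool" where
  "core_subproblem_of B A B1 A11 \<longleftrightarrow>
     (\<exists>P Q R A22. core_form B A P Q R B1 A11 A22 \<and>
       (\<forall>P' Q' R' B1' A11' A22'. core_form B A P' Q' R' B1' A11' A22' \<longrightarrow>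
          dim_row B1 \<le> dim_row B1' \<and> dim_col B1 \<le> dim_col B1' \<and>
          dim_col A11 \<le> dim_col A11' \<and>
          dim_row A22' \<le> dim_row A22 \<and> dim_col A22' \<le> dim_col A22))"

definition core_problem :: "complex mat \<Rightarrow> complex mat \<Rightarrow> bool" where
  "core_problem B1 A11 \<longleftrightarrow>
     (\<exists>m n d A B. A \<in> carrier_mat m n \<and> B \<in> carrier_mat m d \<and>
       mat_adjoint A * B \<noteq> 0\<^sub>m n d \<and>
       \<not> vec_space.col_space m B \<subseteq> vec_space.col_space m A \<and>
       core_subproblem_of B A B1 A11)"

text \<open>
  A component of a reduced structure may have an \<open>A\<close>-block without columns, or be compatible
  (for instance \<open>[1 | ]\<close> and \<open>[1 | 1]\<close> in \<open>[1 0 | 0; 0 1 | 1]\<close>). Such a component does not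
  arise from data with \<open>A\<^sup>* B \<noteq> 0\<close> and \<open>\<R>(B) \<not>\<subseteq> \<R>(A)\<close>. So these two conditions are imposed on the
  overall core problem only; for a component, being a core problem is the minimality condition.
\<close>

definition component_core_problem :: "complex mat \<Rightarrow> complex mat \<Rightarrow> bool" where
  "component_core_problem B1 A11 \<longleftrightarrow> (\<exists>B A. core_subproblem_of B A B1 A11)"

text \<open>
  The list \<open>cs\<close> consists of the pairs \<open>(B\<^sup>(\<^sup>t\<^sup>), A\<^sup>(\<^sup>t\<^sup>))\<close>. A block without columns
  still contributes its rows to \<^const>\<open>diag_block_mat\<close>.
\<close>

definition reduced_structure ::
  "complex mat \<Rightarrow> complex mat \<Rightarrow> complex mat \<Rightarrow> complex mat \<Rightarrow> complex mat \<Rightarrow>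
   (complex mat \<times> complex mat) list \<Rightarrow> bool" where
  "reduced_structure B1 A11 P Q R cs \<longleftrightarrow>
     dim_row B1 = dim_row A11 \<and>
     unitary_mat (dim_row A11) P \<and> unitary_mat (dim_col A11) Q \<and> unitary_mat (dim_col B1) R \<and>
     (\<forall>(Bt, At) \<in> set cs.
        dim_row Bt = dim_row At \<and> 0 < dim_row Bt \<and> 0 < dim_col Bt + dim_col At) \<and>
     mat_adjoint P * B1 * R = diag_block_mat (map fst cs) \<and>
     mat_adjoint P * A11 * Q = diag_block_mat (map snd cs)"

definition reducible :: "complex mat \<Rightarrow> complex mat \<Rightarrow> bool" where
  "reducible B1 A11 \<longleftrightarrow> (\<exists>P Q R cs. reduced_structure B1 A11 P Q R cs \<and> 2 \<le> length cs)"

definition irreducible_reduced_structure ::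
  "complex mat \<Rightarrow> complex mat \<Rightarrow> complex mat \<Rightarrow> complex mat \<Rightarrow> complex mat \<Rightarrow>
   (complex mat \<times> complex mat) list \<Rightarrow> bool" where
  "irreducible_reduced_structure B1 A11 P Q R cs \<longleftrightarrow>
     reduced_structure B1 A11 P Q R cs \<and>
     (\<forall>(Bt, At) \<in> set cs. component_core_problem Bt At \<and> \<not> reducible Bt At)"

end

theory Submission
  imports Defs
begin

text \<open>
  A pair \<open>[B | A]\<close> consists of two linear maps into one common space, and all spaces carry inner
  products. A reduced structure is an orthogonal decomposition of the pair into smaller pairs. The
  theorem is the Krull-Schmidt theorem for such decompositions. Because the decompositions are
  orthogonal, it follows from Schur's lemma and a count.

  The relevant maps from \<open>[B | A]\<close> to \<open>[B' | A']\<close> are the triples \<open>(p, q, r)\<close> with \<open>p B = B' r\<close> and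
  \<open>p A = A' q\<close> which commute with the adjoints of the matrices as well. For such a triple,
  \<open>(p\<^sup>* p, q\<^sup>* q, r\<^sup>* r)\<close> is a Hermitian endomorphism of \<open>[B | A]\<close>, whose eigenspaces split
  \<open>[B | A]\<close> orthogonally. If \<open>[B | A]\<close> is irreducible, this endomorphism is therefore a scalar
  (\<open>hermitian_endomorphism_scalar\<close>). Minimality of core problems enters here: reducibility only counts
  splittings whose parts all have a row and a column, and a core problem has no zero row or column
  that would form a part without columns or without rows (\<open>component_core_row_nonzero\<close>,
  \<open>component_core_col_nonzero\<close>). Consequently, a nonzero map between two irreducible core problems is a
  multiple of a unitary equivalence (\<open>nonzero_intertwiner_equiv\<close>).

  Now let a pair be decomposed in two ways, with isometric embeddings \<open>E i\<close> and \<open>E' j\<close> of the row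
  spaces of the components (\<open>reduced_structure_orthogonal_sum\<close>). The map \<open>(E' j)\<^sup>* E i\<close> between two
  components has a squared Frobenius norm, and dividing it by the row dimension of the component
  gives a number \<open>w i j\<close> which vanishes unless the components are unitarily equivalent. Since both
  families of embeddings exhaust the row space, \<open>w\<close> is doubly stochastic. Hence the rows and columns
  that belong to one equivalence class are equal in number (\<open>stochastic_matching\<close>), so every class
  has as many members in one decomposition as in the other, and a permutation matches them.
\<close>

section \<open>Adjoints and unitary matrices\<close>

lemma dim_mat_adjoint[simp]:
  "dim_row (mat_adjoint A) = dim_col A" "dim_col (mat_adjoint A) = dim_row A"
  by (auto simp: mat_adjoint_def mat_of_rows_def)

lemma mat_adjoint_carrier[simp]:
  "mat_adjoint A \<in> carrier_mat n m \<longleftrightarrow> A \<in> carrier_mat m n"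
  unfolding carrier_mat_def by auto

lemma index_mat_adjoint[simp]:
  fixes A :: "complex mat"
  shows "i < dim_col A \<Longrightarrow> j < dim_row A \<Longrightarrow> mat_adjoint A $$ (i, j) = cnj (A $$ (j, i))"
  by (simp add: mat_adjoint_def mat_of_rows_def conjugate_complex_def)

lemma mat_adjoint_adjoint[simp]:
  fixes A :: "complex mat"
  shows "mat_adjoint (mat_adjoint A) = A"
  by (intro eq_matI) auto

lemma mat_adjoint_one[simp]: "mat_adjoint (1\<^sub>m n :: complex mat) = 1\<^sub>m n"
  by (intro eq_matI) auto

lemma mat_adjoint_zero[simp]: "mat_adjoint (0\<^sub>m m n :: complex mat) = 0\<^sub>m n m"
  by (intro eq_matI) auto

lemma mat_adjoint_smult:
  fixes A :: "complex mat"
  shows "mat_adjoint (c \<cdot>\<^sub>m A) = cnj c \<cdot>\<^sub>m mat_adjoint A"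
  by (intro eq_matI) auto

lemma mult_assoc_dim:
  "dim_col A = dim_row B \<Longrightarrow> dim_col B = dim_row C \<Longrightarrow> A * B * C = A * (B * C :: complex mat)"
  by (rule assoc_mult_mat) auto

lemma mat_adjoint_mult_dim:
  "dim_col A = dim_row B \<Longrightarrow> mat_adjoint (A * B) = mat_adjoint B * mat_adjoint (A :: complex mat)"
  by (intro eq_matI) (auto simp: scalar_prod_def mult.commute)

lemma mult_one_dim:
  "dim_row A = n \<Longrightarrow> 1\<^sub>m n * A = (A :: complex mat)"
  "dim_col A = n \<Longrightarrow> A * 1\<^sub>m n = (A :: complex mat)"
  by auto

lemma smult_mult_dim:
  fixes A B :: "complex mat"
  assumes "dim_col A = dim_row B"
  shows "(c \<cdot>\<^sub>m A) * B = c \<cdot>\<^sub>m (A * B)" "A * (c \<cdot>\<^sub>m B) = c \<cdot>\<^sub>m (A * B)"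
proof -
  have A: "A \<in> carrier_mat (dim_row A) (dim_col A)" and B: "B \<in> carrier_mat (dim_col A) (dim_col B)"
    using assms by auto
  show "(c \<cdot>\<^sub>m A) * B = c \<cdot>\<^sub>m (A * B)" by (rule mult_smult_assoc_mat[OF A B])
  show "A * (c \<cdot>\<^sub>m B) = c \<cdot>\<^sub>m (A * B)" by (rule mult_smult_distrib[OF A B])
qed

text \<open>
  These rewrite rules ask only for matching dimensions, which the simplifier can decide, instead of
  membership in a \<open>carrier_mat\<close> whose intermediate size it would have to guess.
\<close>
lemmas dim_simps = mult_assoc_dim mat_adjoint_mult_dim mult_one_dim

lemma unitary_matD:
  assumes "unitary_mat n U"
  shows "U \<in> carrier_mat n n" "dim_row U = n" "dim_col U = n" "mat_adjoint U * U = 1\<^sub>m n"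
    "U * mat_adjoint U = 1\<^sub>m n"
  using assms by (auto simp: unitary_mat_def)

lemma unitary_matI:
  assumes "U \<in> carrier_mat n n" "mat_adjoint U * U = 1\<^sub>m n"
  shows "unitary_mat n U"
  using assms mat_mult_left_right_inverse[of "mat_adjoint U" n U]
  by (simp add: unitary_mat_def)

lemma unitary_mat_one: "unitary_mat n (1\<^sub>m n)"
  by (simp add: unitary_mat_def)

lemma unitary_mat_adjoint: "unitary_mat n U \<Longrightarrow> unitary_mat n (mat_adjoint U)"
  by (simp add: unitary_mat_def)

lemma unitary_cancel:
  assumes "unitary_mat n U" "dim_row X = n"
  shows "mat_adjoint U * (U * X) = X" "U * (mat_adjoint U * X) = X"
proof -
  note c = unitary_matD[OF assms(1)]
  have "mat_adjoint U * (U * X) = mat_adjoint U * U * X" "U * (mat_adjoint U * X) = U * mat_adjoint U * X"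
    using c(2,3) assms(2) by (simp_all add: mult_assoc_dim)
  then show "mat_adjoint U * (U * X) = X" "U * (mat_adjoint U * X) = X"
    unfolding c(4,5) using assms(2) by (simp_all add: mult_one_dim)
qed

lemma unitary_mat_mult:
  assumes "unitary_mat n U" "unitary_mat n V"
  shows "unitary_mat n (U * V)"
proof (rule unitary_matI)
  note c = unitary_matD[OF assms(1)] unitary_matD[OF assms(2)]
  show "U * V \<in> carrier_mat n n" using c by auto
  show "mat_adjoint (U * V) * (U * V) = 1\<^sub>m n"
    using c by (simp add: dim_simps unitary_cancel[OF assms(1)])
qed

lemma mat_adjoint_four_block:
  fixes A :: "complex mat"
  assumes "A \<in> carrier_mat r1 c1" "B \<in> carrier_mat r1 c2" "C \<in> carrier_mat r2 c1"
    "D \<in> carrier_mat r2 c2"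
  shows "mat_adjoint (four_block_mat A B C D) =
    four_block_mat (mat_adjoint A) (mat_adjoint C) (mat_adjoint B) (mat_adjoint D)"
  using assms by (intro eq_matI) auto

lemma unitary_four_block:
  assumes "unitary_mat a U" "unitary_mat b V"
  shows "unitary_mat (a + b) (four_block_mat U (0\<^sub>m a b) (0\<^sub>m b a) V)"
proof (rule unitary_matI)
  note c = unitary_matD[OF assms(1)] unitary_matD[OF assms(2)]
  show "four_block_mat U (0\<^sub>m a b) (0\<^sub>m b a) V \<in> carrier_mat (a + b) (a + b)" using c by auto
  show "mat_adjoint (four_block_mat U (0\<^sub>m a b) (0\<^sub>m b a) V) *
    four_block_mat U (0\<^sub>m a b) (0\<^sub>m b a) V = 1\<^sub>m (a + b)"
    using c by (simp add: mat_adjoint_four_block[of U a a _ b _ b]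
        mult_four_block_mat[of _ a a _ b _ b _ _ a _ b])
qed

section \<open>Unitary diagonalization of Hermitian matrices\<close>

text \<open>
  Complete \<open>v\<close> to a basis and apply Gram-Schmidt, which keeps the first vector and returns
  orthogonal vectors; it remains to normalize them.
\<close>
lemma unitary_with_first_column:
  assumes v: "v \<in> carrier_vec n" and v0: "v \<noteq> 0\<^sub>v n"
  shows "\<exists>U a. unitary_mat n U \<and> col U 0 = a \<cdot>\<^sub>v (v :: complex vec)"
proof -
  interpret cof_vec_space n "TYPE(complex)" .
  define b where "b = basis_completion v"
  define ws where "ws = gram_schmidt n b"
  have n: "0 < n" using v v0 by (cases n) auto
  note bc = basis_completion[OF v v0, folded b_def]
  obtain vs where bv: "b = v # vs" using bc(6,7) n by (cases b) auto
  note gs = gram_schmidt_result[OF bc(2,4,5) refl, folded ws_def]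
  have hd: "hd ws = v" unfolding ws_def bv using gram_schmidt_hd[OF v] .
  have len: "length ws = n" using gs(4) bc(6) by simp
  define s where "s w = complex_of_real (1 / sqrt (Re (w \<bullet>c w)))" for w :: "complex vec"
  define U where "U = mat n n (\<lambda>(i,j). s (ws ! j) * ws ! j $ i)"
  have wsc: "j < n \<Longrightarrow> ws ! j \<in> carrier_vec n" for j using gs(3) len by auto
  have ip: "i < n \<Longrightarrow> j < n \<Longrightarrow> (ws ! j \<bullet>c ws ! i = 0) = (j \<noteq> i)" for i j
    using gs(2) len unfolding corthogonal_def by auto
  have U: "U \<in> carrier_mat n n" by (simp add: U_def)
  have "mat_adjoint U * U = 1\<^sub>m n"
  proof (rule eq_matI)
    fix i j assume "i < dim_row (1\<^sub>m n :: complex mat)" "j < dim_col (1\<^sub>m n :: complex mat)"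
    then have i: "i < n" and j: "j < n" by auto
    have e: "(mat_adjoint U * U) $$ (i, j) = cnj (s (ws ! i)) * s (ws ! j) * (ws ! j \<bullet>c ws ! i)"
      using i j wsc[OF i] wsc[OF j] U
      by (auto simp: scalar_prod_def U_def sum_distrib_left conjugate_complex_def ac_simps
          intro!: sum.cong)
    show "(mat_adjoint U * U) $$ (i, j) = 1\<^sub>m n $$ (i, j)"
    proof (cases "i = j")
      case False
      then show ?thesis using e ip[OF i j] i j by simp
    next
      case True
      define x where "x = (\<Sum>k<n. (cmod (ws ! i $ k))\<^sup>2)"
      have x: "ws ! i \<bullet>c ws ! i = complex_of_real x"
        using wsc[OF i] by (auto simp: scalar_prod_def x_def conjugate_complex_def
            complex_norm_square atLeast0LessThan simp del: of_real_power)
      have "x \<noteq> 0" using ip[OF i i] x by auto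
      moreover have "x \<ge> 0" unfolding x_def by (intro sum_nonneg) auto
      ultimately have "x > 0" by simp
      then show ?thesis using e x i True
        by (simp add: s_def flip: of_real_mult)
    qed
  qed (use U in auto)
  then have "unitary_mat n U" using U by (rule unitary_matI[rotated])
  moreover have "col U 0 = s v \<cdot>\<^sub>v v"
    using n v hd hd_conv_nth[of ws] len by (intro eq_vecI) (force simp: U_def)+
  ultimately show ?thesis by blast
qed

lemma exists_eigenvector:
  fixes H :: "complex mat"
  assumes H: "H \<in> carrier_mat (Suc n) (Suc n)"
  shows "\<exists>v e. v \<in> carrier_vec (Suc n) \<and> v \<noteq> 0\<^sub>v (Suc n) \<and> H *\<^sub>v v = e \<cdot>\<^sub>v v"
proof -
  obtain as where "char_poly H = (\<Prod>a\<leftarrow>as. [:- a, 1:])" "length as = Suc n"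
    using char_poly_factorized[OF H] by blast
  then obtain e where "poly (char_poly H) e = 0" by (cases as) auto
  then have "eigenvalue H e" using eigenvalue_root_char_poly[OF H] by simp
  then show ?thesis using H unfolding eigenvalue_def eigenvector_def by auto
qed

text \<open>
  The spectral theorem, by deflation: in an orthonormal basis starting with an eigenvector the first
  column of \<open>H\<close> is \<open>e\<close> times the first unit vector, and as \<open>H\<close> is Hermitian so is the first row.
\<close>
lemma hermitian_unitary_diagonalization:
  assumes "H \<in> carrier_mat n n" "mat_adjoint H = H"
  shows "\<exists>U d. unitary_mat n U \<and> mat_adjoint U * H * U = mat_diag n d"
  using assms
proof (induction n arbitrary: H)
  case 0
  then show ?case using unitary_mat_one[of 0] by (intro exI[of _ "1\<^sub>m 0"]) (auto simp: mat_diag_def intro!: eq_matI)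
next
  case (Suc n)
  note H = Suc.prems(1)
  obtain v e where v: "v \<in> carrier_vec (Suc n)" "v \<noteq> 0\<^sub>v (Suc n)" "H *\<^sub>v v = e \<cdot>\<^sub>v v"
    using exists_eigenvector[OF H] by blast
  obtain W a where W: "unitary_mat (Suc n) W" and W0: "col W 0 = a \<cdot>\<^sub>v v"
    using unitary_with_first_column[OF v(1,2)] by blast
  note Wc = unitary_matD[OF W]
  define K where "K = mat_adjoint W * H * W"
  have K: "K \<in> carrier_mat (Suc n) (Suc n)" using Wc H by (auto simp: K_def)
  have Kh: "mat_adjoint K = K"
    using Wc(2,3) H Suc.prems(2) by (simp add: K_def dim_simps)
  have K0: "K $$ (i, 0) = (if i = 0 then e else 0)" if i: "i < Suc n" for i
  proof -
    have "K = mat_adjoint W * (H * W)" using Wc(2,3) H by (simp add: K_def dim_simps)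
    then have "K $$ (i, 0) = row (mat_adjoint W) i \<bullet> col (H * W) 0"
      using i Wc H by simp
    also have "col (H * W) 0 = H *\<^sub>v col W 0" using Wc H by (intro col_mult2) auto
    also have "\<dots> = e \<cdot>\<^sub>v col W 0" unfolding W0 using v H
      by (simp add: mult_mat_vec[of H "Suc n" "Suc n"] smult_smult_assoc mult.commute)
    also have "row (mat_adjoint W) i \<bullet> (e \<cdot>\<^sub>v col W 0) = e * (row (mat_adjoint W) i \<bullet> col W 0)"
      using Wc i by (intro scalar_prod_smult_right) auto
    also have "row (mat_adjoint W) i \<bullet> col W 0 = (mat_adjoint W * W) $$ (i, 0)"
      using Wc(1) i by simp
    finally show ?thesis unfolding Wc(4) using i by (simp del: index_mult_mat)
  qed
  \<comment> \<open>The same for the first row, as the matrix is Hermitian.\<close>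
  have K0': "K $$ (0, i) = (if i = 0 then e else 0)" if "i < Suc n" for i
  proof (cases "i = 0")
    case False
    have "K $$ (0, i) = mat_adjoint K $$ (0, i)" by (simp add: Kh)
    also have "\<dots> = cnj (K $$ (i, 0))" using K that by (intro index_mat_adjoint) auto
    finally show ?thesis using K0[OF that] False by simp
  qed (use K0[OF that] in simp)
  define L where "L = mat n n (\<lambda>(i, j). K $$ (Suc i, Suc j))"
  have L: "L \<in> carrier_mat n n" by (simp add: L_def)
  have "mat_adjoint L = L"
  proof (rule eq_matI)
    fix i j assume "i < dim_row L" "j < dim_col L"
    then have ij: "i < n" "j < n" by (auto simp: L_def)
    have "L $$ (i, j) = mat_adjoint K $$ (Suc i, Suc j)" using ij by (simp add: L_def Kh)
    also have "\<dots> = cnj (K $$ (Suc j, Suc i))" using ij K by (intro index_mat_adjoint) auto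
    finally show "mat_adjoint L $$ (i, j) = L $$ (i, j)" using ij by (simp add: L_def)
  qed (use L in auto)
  from Suc.IH[OF L this] obtain V d where V: "unitary_mat n V"
    and Vd: "mat_adjoint V * L * V = mat_diag n d" by blast
  note Vc = unitary_matD[OF V]
  define X where "X = four_block_mat (1\<^sub>m 1) (0\<^sub>m 1 n) (0\<^sub>m n 1) V"
  have X: "unitary_mat (Suc n) X"
    using unitary_four_block[OF unitary_mat_one[of 1] V] by (simp add: X_def)
  note Xc = unitary_matD[OF X]
  have KL: "K = four_block_mat (mat 1 1 (\<lambda>_. e)) (0\<^sub>m 1 n) (0\<^sub>m n 1) L"
  proof (rule eq_matI)
    fix i j assume "i < dim_row (four_block_mat (mat 1 1 (\<lambda>_. e)) (0\<^sub>m 1 n) (0\<^sub>m n 1) L)"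
      "j < dim_col (four_block_mat (mat 1 1 (\<lambda>_. e)) (0\<^sub>m 1 n) (0\<^sub>m n 1) L)"
    then have "i < Suc n" "j < Suc n" using L by auto
    then show "K $$ (i, j) = four_block_mat (mat 1 1 (\<lambda>_. e)) (0\<^sub>m 1 n) (0\<^sub>m n 1) L $$ (i, j)"
      using K0[of i] K0'[of j] L by (cases i; cases j) (auto simp: L_def)
  qed (use K L in auto)
  have "mat_adjoint (W * X) * H * (W * X) = mat_adjoint X * K * X"
    using Wc(2,3) Xc(2,3) H by (simp add: K_def dim_simps)
  also have "\<dots> = four_block_mat (mat 1 1 (\<lambda>_. e)) (0\<^sub>m 1 n) (0\<^sub>m n 1) (mat_adjoint V * L * V)"
    unfolding KL X_def using Vc L
    by (simp add: mat_adjoint_four_block[of _ 1 1 _ n _ n]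
        mult_four_block_mat[of _ 1 1 _ n _ n _ _ 1 _ n])
  also have "\<dots> = mat_diag (Suc n) (\<lambda>i. if i = 0 then e else d (i - 1))"
    unfolding Vd by (intro eq_matI) (auto simp: mat_diag_def)
  finally show ?case using unitary_mat_mult[OF W X] by blast
qed

lemma conj_permuted_cols:
  fixes X :: "complex mat"
  assumes "U \<in> carrier_mat m m" "V \<in> carrier_mat n n" "X \<in> carrier_mat m n"
    and "\<And>i. i < m \<Longrightarrow> \<sigma> i < m" "\<And>i. i < n \<Longrightarrow> \<tau> i < n"
  shows "mat_adjoint (mat m m (\<lambda>(i, j). U $$ (i, \<sigma> j))) * X * mat n n (\<lambda>(i, j). V $$ (i, \<tau> j)) =
    mat m n (\<lambda>(i, j). (mat_adjoint U * X * V) $$ (\<sigma> i, \<tau> j))"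
  using assms by (intro eq_matI) (auto simp: scalar_prod_def simp del: assoc_mult_mat)

lemma permutes_lessThan: "\<sigma> permutes {..<n} \<Longrightarrow> i < n \<Longrightarrow> \<sigma> i < (n :: nat)"
  using permutes_in_image[of \<sigma> "{..<n}" i] by simp

lemma permutes_eq_iff: "\<sigma> permutes A \<Longrightarrow> \<sigma> i = \<sigma> j \<longleftrightarrow> i = j"
  using permutes_inj[of \<sigma> A] by (auto dest: injD)

lemma unitary_permuted_cols:
  assumes U: "unitary_mat n U" and s: "\<sigma> permutes {..<n}"
  shows "unitary_mat n (mat n n (\<lambda>(i, j). U $$ (i, \<sigma> j)))" (is "unitary_mat n ?V")
proof (rule unitary_matI)
  have "mat_adjoint ?V * 1\<^sub>m n * ?V = mat n n (\<lambda>(i, j). (mat_adjoint U * 1\<^sub>m n * U) $$ (\<sigma> i, \<sigma> j))"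
    using unitary_matD(1)[OF U] permutes_lessThan[OF s] by (intro conj_permuted_cols) auto
  also have "mat_adjoint U * 1\<^sub>m n * U = 1\<^sub>m n"
    using unitary_matD[OF U] by (simp add: dim_simps)
  finally show "mat_adjoint ?V * ?V = 1\<^sub>m n"
    using permutes_lessThan[OF s] permutes_eq_iff[OF s] by (auto simp: mult_one_dim intro!: eq_matI)
qed simp

text \<open>
  Permuting the columns of \<open>U\<close> moves the eigenvalues with the property \<open>S\<close> to the front, so that
  the corresponding splitting of the space becomes a splitting into two blocks.
\<close>
lemma sort_diagonalization:
  assumes U: "unitary_mat n U" and H: "H \<in> carrier_mat n n"
    and Ud: "mat_adjoint U * H * U = mat_diag n d"
  shows "\<exists>V \<sigma> k. unitary_mat n V \<and> \<sigma> permutes {..<n} \<and> k \<le> n \<and>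
    mat_adjoint V * H * V = mat_diag n (d \<circ> \<sigma>) \<and> (\<forall>i<n. S (d (\<sigma> i)) \<longleftrightarrow> i < k)"
proof -
  note Uc = unitary_matD[OF U]
  define xs where "xs = map d [0..<n]"
  define k where "k = length (filter S xs)"
  have "mset (filter S xs @ filter (\<lambda>x. \<not> S x) xs) = mset xs"
    by simp
  then obtain \<sigma> where s0: "\<sigma> permutes {..<length xs}"
    and sx: "permute_list \<sigma> xs = filter S xs @ filter (\<lambda>x. \<not> S x) xs"
    by (rule mset_eq_permutation)
  have len: "length xs = n" by (simp add: xs_def)
  note s = s0[unfolded len]
  note sn = permutes_lessThan[OF s]
  have d: "S (d (\<sigma> i)) \<longleftrightarrow> i < k" if i: "i < n" for i
  proof -
    have e: "d (\<sigma> i) = (filter S xs @ filter (\<lambda>x. \<not> S x) xs) ! i"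
      using permute_list_nth[OF s0, of i] sn[OF i] i len unfolding sx by (simp add: xs_def)
    have l: "length (filter S xs @ filter (\<lambda>x. \<not> S x) xs) = n"
      using sx len by (metis length_permute_list)
    show ?thesis
    proof (cases "i < k")
      case True
      then have "filter S xs ! i \<in> set (filter S xs)" unfolding k_def by (rule nth_mem)
      then show ?thesis using e True by (auto simp: nth_append k_def)
    next
      case False
      then have "i - k < length (filter (\<lambda>x. \<not> S x) xs)" using l i by (simp add: k_def)
      then have "filter (\<lambda>x. \<not> S x) xs ! (i - k) \<in> set (filter (\<lambda>x. \<not> S x) xs)" by (rule nth_mem)
      then show ?thesis using e False by (auto simp: nth_append k_def)
    qed
  qed
  define V where "V = mat n n (\<lambda>(i, j). U $$ (i, \<sigma> j))"
  have "mat_adjoint V * H * V = mat n n (\<lambda>(i, j). (mat_adjoint U * H * U) $$ (\<sigma> i, \<sigma> j))"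
    unfolding V_def using Uc H sn by (intro conj_permuted_cols) auto
  also have "\<dots> = mat_diag n (d \<circ> \<sigma>)"
    unfolding Ud using sn by (intro eq_matI) (auto simp: mat_diag_def permutes_eq_iff[OF s])
  finally have "mat_adjoint V * H * V = mat_diag n (d \<circ> \<sigma>)" .
  moreover have "unitary_mat n V" unfolding V_def by (rule unitary_permuted_cols[OF U s])
  moreover have "k \<le> n" unfolding k_def len[symmetric] by (rule length_filter_le)
  ultimately show ?thesis using d s by blast
qed

section \<open>Core problems have no superfluous rows or columns\<close>

text \<open>
  If unitary transformations make the trailing rows and columns of the core blocks zero, these rows
  and columns can be moved over: those of \<open>A11\<close> become leading zero rows and columns of a larger
  \<open>A22\<close>, and those of \<open>B1\<close> join the zero blocks next to it. A core problem cannot admit this, as its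
  dimensions are minimal.
\<close>
lemma core_form_shrink:
  assumes cf: "core_form B A P Q R B1 A11 A22"
    and P0: "unitary_mat (dim_row A11) P0" and Q0: "unitary_mat (dim_col A11) Q0"
    and R0: "unitary_mat (dim_col B1) R0"
    and r: "r \<le> dim_row A11" and c: "c \<le> dim_col A11" and d: "d \<le> dim_col B1"
    and zB: "\<And>i j. i < dim_row A11 \<Longrightarrow> j < dim_col B1 \<Longrightarrow> r \<le> i \<or> d \<le> j \<Longrightarrow>
      (mat_adjoint P0 * B1 * R0) $$ (i, j) = 0"
    and zA: "\<And>i j. i < dim_row A11 \<Longrightarrow> j < dim_col A11 \<Longrightarrow> r \<le> i \<or> c \<le> j \<Longrightarrow>
      (mat_adjoint P0 * A11 * Q0) $$ (i, j) = 0"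
  shows "\<exists>P' Q' R' B1' A11' A22'. core_form B A P' Q' R' B1' A11' A22' \<and>
    dim_row B1' = r \<and> dim_col B1' = d \<and> dim_col A11' = c"
proof -
  define m1 n1 d1 m2 n2 d2 where dims: "m1 = dim_row A11" "n1 = dim_col A11" "d1 = dim_col B1"
    "m2 = dim_row A22" "n2 = dim_col A22" "d2 = dim_col B - dim_col B1"
  from cf have rows: "dim_row B = dim_row A" "dim_row B1 = dim_row A11"
    and U: "unitary_mat (dim_row A) P" "unitary_mat (dim_col A) Q" "unitary_mat (dim_col B) R"
    and dB: "dim_col B1 \<le> dim_col B"
    and eB: "mat_adjoint P * B * R = four_block_mat B1 (0\<^sub>m m1 d2) (0\<^sub>m m2 d1) (0\<^sub>m m2 d2)"
    and eA: "mat_adjoint P * A * Q = four_block_mat A11 (0\<^sub>m m1 n2) (0\<^sub>m m2 n1) A22"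
    unfolding core_form_def dims by auto
  note P = unitary_matD[OF U(1)] note Q = unitary_matD[OF U(2)] note R = unitary_matD[OF U(3)]
  have dA: "dim_row A = m1 + m2" "dim_col A = n1 + n2"
    using arg_cong[OF eA, of dim_row] arg_cong[OF eA, of dim_col] P Q by (auto simp: dims)
  have dB': "dim_col B = d1 + d2" using dB by (simp add: dims)
  have cB1: "B1 \<in> carrier_mat m1 d1" and cA11: "A11 \<in> carrier_mat m1 n1"
    and cA22: "A22 \<in> carrier_mat m2 n2"
    using rows by (auto simp: dims)
  define X where "X = mat_adjoint P0 * B1 * R0"
  define Y where "Y = mat_adjoint P0 * A11 * Q0"
  note P0c = unitary_matD[OF P0, folded dims] and Q0c = unitary_matD[OF Q0, folded dims]
    and R0c = unitary_matD[OF R0, folded dims]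
  have cX: "X \<in> carrier_mat m1 d1" using P0c R0c by (auto simp: X_def)
  have cY: "Y \<in> carrier_mat m1 n1" using P0c Q0c by (auto simp: Y_def)
  define PP where "PP = four_block_mat P0 (0\<^sub>m m1 m2) (0\<^sub>m m2 m1) (1\<^sub>m m2)"
  define QQ where "QQ = four_block_mat Q0 (0\<^sub>m n1 n2) (0\<^sub>m n2 n1) (1\<^sub>m n2)"
  define RR where "RR = four_block_mat R0 (0\<^sub>m d1 d2) (0\<^sub>m d2 d1) (1\<^sub>m d2)"
  have UU: "unitary_mat (m1 + m2) PP" "unitary_mat (n1 + n2) QQ" "unitary_mat (d1 + d2) RR"
    unfolding PP_def QQ_def RR_def
    using P0 Q0 R0 by (auto intro!: unitary_four_block unitary_mat_one simp: dims)
  note PPc = unitary_matD[OF UU(1)] and QQc = unitary_matD[OF UU(2)] and RRc = unitary_matD[OF UU(3)]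
  define B1' where "B1' = mat r d (\<lambda>(i, j). X $$ (i, j))"
  define A11' where "A11' = mat r c (\<lambda>(i, j). Y $$ (i, j))"
  define A22' where "A22' = mat (m1 - r + m2) (n1 - c + n2) (\<lambda>(i, j).
    if i < m1 - r \<or> j < n1 - c then 0 else A22 $$ (i - (m1 - r), j - (n1 - c)))"
  have "mat_adjoint (P * PP) * B * (R * RR) = mat_adjoint PP * (mat_adjoint P * B * R) * RR"
    using P(2,3) R(2,3) PPc(2,3) RRc(2,3) rows dA dB' by (simp add: dim_simps)
  also have "\<dots> = four_block_mat X (0\<^sub>m m1 d2) (0\<^sub>m m2 d1) (0\<^sub>m m2 d2)"
    unfolding eB PP_def RR_def using P0c(1) R0c(1) cB1
    by (simp add: X_def mat_adjoint_four_block[of _ m1 m1 _ m2 _ m2]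
        mult_four_block_mat[of _ m1 m1 _ m2 _ m2 _ _ d1 _ d2]
        mult_four_block_mat[of _ m1 d1 _ d2 _ m2 _ _ d1 _ d2])
  also have "\<dots> = four_block_mat B1' (0\<^sub>m (dim_row B1') (dim_col B - dim_col B1'))
    (0\<^sub>m (dim_row A22') (dim_col B1')) (0\<^sub>m (dim_row A22') (dim_col B - dim_col B1'))"
    using zB[folded X_def dims] cX r d dB' unfolding dims(1,3)[symmetric]
    by (intro eq_matI) (auto simp: B1'_def A22'_def)
  finally have 1: "mat_adjoint (P * PP) * B * (R * RR) = \<dots>" .
  have "mat_adjoint (P * PP) * A * (Q * QQ) = mat_adjoint PP * (mat_adjoint P * A * Q) * QQ"
    using P(2,3) Q(2,3) PPc(2,3) QQc(2,3) rows dA dB' by (simp add: dim_simps)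
  also have "\<dots> = four_block_mat Y (0\<^sub>m m1 n2) (0\<^sub>m m2 n1) A22"
    unfolding eA PP_def QQ_def using P0c(1) Q0c(1) cA11 cA22
    by (simp add: Y_def mat_adjoint_four_block[of _ m1 m1 _ m2 _ m2]
        mult_four_block_mat[of _ m1 m1 _ m2 _ m2 _ _ n1 _ n2]
        mult_four_block_mat[of _ m1 n1 _ n2 _ m2 _ _ n1 _ n2])
  also have "\<dots> = four_block_mat A11' (0\<^sub>m (dim_row A11') (dim_col A22'))
    (0\<^sub>m (dim_row A22') (dim_col A11')) A22'"
    using zA[folded Y_def dims] cY cA22 r c unfolding dims(1,2)[symmetric]
    by (intro eq_matI) (auto simp: A11'_def A22'_def)
  finally have 2: "mat_adjoint (P * PP) * A * (Q * QQ) = \<dots>" .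
  have "core_form B A (P * PP) (Q * QQ) (R * RR) B1' A11' A22'"
    unfolding core_form_def
  proof (intro conjI)
    show "unitary_mat (dim_row A) (P * PP)" using U(1) UU(1) by (simp add: dA unitary_mat_mult)
    show "unitary_mat (dim_col A) (Q * QQ)" using U(2) UU(2) by (simp add: dA unitary_mat_mult)
    show "unitary_mat (dim_col B) (R * RR)" using U(3) UU(3) by (simp add: dB' unitary_mat_mult)
    show "dim_col B1' \<le> dim_col B" using d dB by (simp add: B1'_def)
  qed (use rows(1) 1 2 in \<open>simp_all only: B1'_def A11'_def dim_row_mat\<close>)
  moreover have "dim_row B1' = r" "dim_col B1' = d" "dim_col A11' = c"
    by (simp_all add: A11'_def B1'_def)
  ultimately show ?thesis by blast
qed

lemma component_core_minimal:
  assumes "component_core_problem B A"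
    and "unitary_mat (dim_row A) P" "unitary_mat (dim_col A) Q" "unitary_mat (dim_col B) R"
    and "r \<le> dim_row A" "c \<le> dim_col A" "d \<le> dim_col B"
    and "\<And>i j. i < dim_row A \<Longrightarrow> j < dim_col B \<Longrightarrow> r \<le> i \<or> d \<le> j \<Longrightarrow>
      (mat_adjoint P * B * R) $$ (i, j) = 0"
    and "\<And>i j. i < dim_row A \<Longrightarrow> j < dim_col A \<Longrightarrow> r \<le> i \<or> c \<le> j \<Longrightarrow>
      (mat_adjoint P * A * Q) $$ (i, j) = 0"
  shows "r = dim_row A" "c = dim_col A" "d = dim_col B"
proof -
  obtain B0 A0 P0 Q0 R0 A22 where cf: "core_form B0 A0 P0 Q0 R0 B A A22"
    and min: "\<And>P' Q' R' B1' A11' A22'. core_form B0 A0 P' Q' R' B1' A11' A22' \<Longrightarrow>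
      dim_row B \<le> dim_row B1' \<and> dim_col B \<le> dim_col B1' \<and> dim_col A \<le> dim_col A11'"
    using assms(1) unfolding component_core_problem_def core_subproblem_of_def by blast
  have "\<exists>P' Q' R' B1' A11' A22'. core_form B0 A0 P' Q' R' B1' A11' A22' \<and>
    dim_row B1' = r \<and> dim_col B1' = d \<and> dim_col A11' = c"
    by (rule core_form_shrink[OF cf assms(2-7)]) (use assms(8,9) in blast)+
  then have "dim_row B \<le> r" "dim_col B \<le> d" "dim_col A \<le> c"
    using min by blast+
  moreover have "dim_row B = dim_row A" using cf by (auto simp: core_form_def)
  ultimately show "r = dim_row A" "c = dim_col A" "d = dim_col B"
    using assms(5-7) by simp_all
qed

lemma unitary_swap_last:
  assumes "unitary_mat n U" "j < n"
  shows "unitary_mat n (mat n n (\<lambda>(i, l). U $$ (i, Transposition.transpose j (n - 1) l)))"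
  using assms by (intro unitary_permuted_cols permutes_swap_id) auto

lemma transpose_last_less:
  "j < n \<Longrightarrow> l < n \<Longrightarrow> Transposition.transpose j (n - 1) l < (n :: nat)"
  by (auto simp: Transposition.transpose_def)

lemma transpose_last_eq:
  assumes "n - 1 \<le> l" "l < (n :: nat)"
  shows "Transposition.transpose j (n - 1) l = j"
proof -
  have "l = n - 1" using assms by simp
  then show ?thesis by simp
qed

text \<open>
  A row which vanishes in both blocks can be swapped with the last one and then be dropped, which
  contradicts minimality.
\<close>
lemma component_core_row_nonzero:
  assumes core: "component_core_problem B A" and rows: "dim_row B = dim_row A"
    and P: "unitary_mat (dim_row A) P" and Q: "unitary_mat (dim_col A) Q"
    and R: "unitary_mat (dim_col B) R" and i: "i < dim_row A"
  shows "(\<exists>j<dim_col B. (mat_adjoint P * B * R) $$ (i, j) \<noteq> 0) \<or>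
    (\<exists>j<dim_col A. (mat_adjoint P * A * Q) $$ (i, j) \<noteq> 0)"
proof (rule ccontr)
  define \<sigma> where "\<sigma> = Transposition.transpose i (dim_row A - 1)"
  define P' where "P' = mat (dim_row A) (dim_row A) (\<lambda>(k, l). P $$ (k, \<sigma> l))"
  assume "\<not> ?thesis"
  then have zB: "\<And>j. j < dim_col B \<Longrightarrow> (mat_adjoint P * B * R) $$ (i, j) = 0"
    and zA: "\<And>j. j < dim_col A \<Longrightarrow> (mat_adjoint P * A * Q) $$ (i, j) = 0" by auto
  note sl = transpose_last_less[OF i, folded \<sigma>_def]
  have s: "\<sigma> l = i" if "dim_row A - 1 \<le> l" "l < dim_row A" for l
    unfolding \<sigma>_def by (rule transpose_last_eq[OF that])
  note Pc = unitary_matD[OF P] and Qc = unitary_matD[OF Q] and Rc = unitary_matD[OF R]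
  \<comment> \<open>The identity permutation brings the factor that is left alone into the form of \<open>conj_permuted_cols\<close>.\<close>
  have id: "X = mat n n (\<lambda>(k, l). X $$ (k, id l))" if "X \<in> carrier_mat n n" for X :: "complex mat" and n
    using that by auto
  have "mat_adjoint P' * B * R = mat (dim_row A) (dim_col B) (\<lambda>(k, l). (mat_adjoint P * B * R) $$ (\<sigma> k, id l))"
    unfolding P'_def
    by (subst id[OF Rc(1)], rule conj_permuted_cols) (use Pc Rc rows sl in auto)
  moreover have "mat_adjoint P' * A * Q = mat (dim_row A) (dim_col A) (\<lambda>(k, l). (mat_adjoint P * A * Q) $$ (\<sigma> k, id l))"
    unfolding P'_def
    by (subst id[OF Qc(1)], rule conj_permuted_cols) (use Pc Qc rows sl in auto)
  moreover have "unitary_mat (dim_row A) P'"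
    unfolding P'_def \<sigma>_def by (rule unitary_swap_last[OF P i])
  ultimately have "dim_row A - 1 = dim_row A"
    using zA zB s by (intro component_core_minimal(1)[OF core _ Q R, of P' _ "dim_col A" "dim_col B"]) auto
  then show False using i by simp
qed

lemma component_core_col_nonzero:
  assumes core: "component_core_problem B A" and rows: "dim_row B = dim_row A"
    and P: "unitary_mat (dim_row A) P" and Q: "unitary_mat (dim_col A) Q"
    and R: "unitary_mat (dim_col B) R"
  shows "j < dim_col B \<Longrightarrow> \<exists>i<dim_row A. (mat_adjoint P * B * R) $$ (i, j) \<noteq> 0"
    and "j < dim_col A \<Longrightarrow> \<exists>i<dim_row A. (mat_adjoint P * A * Q) $$ (i, j) \<noteq> 0"
proof -
  note Pc = unitary_matD[OF P] and Qc = unitary_matD[OF Q] and Rc = unitary_matD[OF R]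
  have id: "X = mat n n (\<lambda>(k, l). X $$ (k, id l))" if "X \<in> carrier_mat n n" for X :: "complex mat" and n
    using that by auto
  show "\<exists>i<dim_row A. (mat_adjoint P * B * R) $$ (i, j) \<noteq> 0" if j: "j < dim_col B"
  proof (rule ccontr)
    define \<sigma> where "\<sigma> = Transposition.transpose j (dim_col B - 1)"
    define R' where "R' = mat (dim_col B) (dim_col B) (\<lambda>(k, l). R $$ (k, \<sigma> l))"
    assume "\<not> ?thesis"
    then have zB: "\<And>i. i < dim_row A \<Longrightarrow> (mat_adjoint P * B * R) $$ (i, j) = 0" by auto
    note sl = transpose_last_less[OF j, folded \<sigma>_def]
    have s: "\<sigma> l = j" if "dim_col B - 1 \<le> l" "l < dim_col B" for l
      unfolding \<sigma>_def by (rule transpose_last_eq[OF that])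
    have "mat_adjoint P * B * R' = mat (dim_row A) (dim_col B) (\<lambda>(k, l). (mat_adjoint P * B * R) $$ (id k, \<sigma> l))"
      unfolding R'_def
      by (subst id[OF Pc(1)], rule conj_permuted_cols) (use Pc Rc rows sl in auto)
    moreover have "unitary_mat (dim_col B) R'"
      unfolding R'_def \<sigma>_def by (rule unitary_swap_last[OF R j])
    ultimately have "dim_col B - 1 = dim_col B"
      using zB s by (intro component_core_minimal(3)[OF core P Q, of R' "dim_row A" "dim_col A"]) auto
    then show False using j by simp
  qed
  show "\<exists>i<dim_row A. (mat_adjoint P * A * Q) $$ (i, j) \<noteq> 0" if j: "j < dim_col A"
  proof (rule ccontr)
    define \<sigma> where "\<sigma> = Transposition.transpose j (dim_col A - 1)"
    define Q' where "Q' = mat (dim_col A) (dim_col A) (\<lambda>(k, l). Q $$ (k, \<sigma> l))"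
    assume "\<not> ?thesis"
    then have zA: "\<And>i. i < dim_row A \<Longrightarrow> (mat_adjoint P * A * Q) $$ (i, j) = 0" by auto
    note sl = transpose_last_less[OF j, folded \<sigma>_def]
    have s: "\<sigma> l = j" if "dim_col A - 1 \<le> l" "l < dim_col A" for l
      unfolding \<sigma>_def by (rule transpose_last_eq[OF that])
    have "mat_adjoint P * A * Q' = mat (dim_row A) (dim_col A) (\<lambda>(k, l). (mat_adjoint P * A * Q) $$ (id k, \<sigma> l))"
      unfolding Q'_def
      by (subst id[OF Pc(1)], rule conj_permuted_cols) (use Pc Qc rows sl in auto)
    moreover have "unitary_mat (dim_col A) Q'"
      unfolding Q'_def \<sigma>_def by (rule unitary_swap_last[OF Q j])
    ultimately have "dim_col A - 1 = dim_col A"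
      using zA s by (intro component_core_minimal(2)[OF core P _ R, of Q' "dim_row A" _ "dim_col B"]) auto
    then show False using j by simp
  qed
qed

section \<open>Hermitian endomorphisms of an irreducible core problem\<close>

text \<open>
  A matrix which intertwines two diagonal matrices has nonzero entries only where the two eigenvalues
  agree: entry \<open>(i, j)\<close> satisfies \<open>dp i * x = x * dr j\<close>.
\<close>
lemma intertwined_entries:
  assumes U: "unitary_mat m U" and W: "unitary_mat n W"
    and X: "X \<in> carrier_mat m n" and p: "p \<in> carrier_mat m m" and r: "r \<in> carrier_mat n n"
    and c: "p * X = X * r"
    and Up: "mat_adjoint U * p * U = mat_diag m dp" and Wr: "mat_adjoint W * r * W = mat_diag n dr"
    and ij: "i < m" "j < n" and ne: "dp i \<noteq> dr j"
  shows "(mat_adjoint U * X * W) $$ (i, j) = 0"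
proof -
  note Uc = unitary_matD[OF U] and Wc = unitary_matD[OF W]
  define Y where "Y = mat_adjoint U * X * W"
  have Y: "Y \<in> carrier_mat m n" using Uc Wc by (auto simp: Y_def)
  have "mat_diag m dp * Y = mat_adjoint U * (p * X) * W"
    unfolding Up[symmetric] Y_def using Uc(2,3) Wc(2,3) X p
    by (simp add: dim_simps unitary_cancel[OF U])
  also have "\<dots> = Y * mat_diag n dr"
    unfolding Wr[symmetric] Y_def c using Uc(2,3) Wc(2,3) X r
    by (simp add: dim_simps unitary_cancel[OF W])
  finally have "dp i * Y $$ (i, j) = Y $$ (i, j) * dr j"
    using ij by (simp add: mat_diag_mult_left[OF Y] mat_diag_mult_right[OF Y] mat_eq_iff)
  then show ?thesis using ne by (auto simp: Y_def mult.commute)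
qed

lemma scalar_of_diag:
  assumes U: "unitary_mat n U" and H: "H \<in> carrier_mat n n"
    and Ud: "mat_adjoint U * H * U = mat_diag n d" and c: "\<And>i. i < n \<Longrightarrow> d i = c"
  shows "H = c \<cdot>\<^sub>m 1\<^sub>m n"
proof -
  note Uc = unitary_matD[OF U]
  have "mat_diag n d = c \<cdot>\<^sub>m 1\<^sub>m n" using c by (intro eq_matI) (auto simp: mat_diag_def)
  then have "U * (mat_adjoint U * H * U) * mat_adjoint U = U * (c \<cdot>\<^sub>m 1\<^sub>m n) * mat_adjoint U"
    using Ud by simp
  also have "U * (mat_adjoint U * H * U) * mat_adjoint U = H"
    using Uc(2,3,5) H by (simp add: dim_simps unitary_cancel[OF U])
  also have "U * (c \<cdot>\<^sub>m 1\<^sub>m n) = c \<cdot>\<^sub>m U"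
    using Uc(1) by (simp add: mult_smult_distrib[of U n n "1\<^sub>m n" n])
  also have "c \<cdot>\<^sub>m U * mat_adjoint U = c \<cdot>\<^sub>m (U * mat_adjoint U)"
    using Uc(1) by (intro mult_smult_assoc_mat) auto
  finally show ?thesis by (simp add: Uc(5))
qed

text \<open>
  Take an eigenvalue \<open>c\<close> of \<open>p\<close>. In eigenbases of \<open>p\<close>, \<open>q\<close> and \<open>r\<close>, ordered so that the eigenvectors
  for \<open>c\<close> come first, \<open>B\<close> and \<open>A\<close> do not mix these eigenvectors with the others. So \<open>[B | A]\<close> splits
  into two blocks. A splitting counts as a reduction only if both blocks have a row and a column; for a
  core problem this fails only if one of the blocks is empty, because no row and no column is zero.
  Since the first block is not empty, the second one is, and all eigenvalues equal \<open>c\<close>.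
\<close>
lemma hermitian_endomorphism_scalar:
  assumes core: "component_core_problem B A" and irr: "\<not> reducible B A"
    and rows: "dim_row B = m" "dim_row A = m" and cols: "dim_col A = n" "dim_col B = d" and m: "0 < m"
    and p: "p \<in> carrier_mat m m" "mat_adjoint p = p"
    and q: "q \<in> carrier_mat n n" "mat_adjoint q = q"
    and r: "r \<in> carrier_mat d d" "mat_adjoint r = r"
    and pB: "p * B = B * r" and pA: "p * A = A * q"
  shows "\<exists>c. p = c \<cdot>\<^sub>m 1\<^sub>m m \<and> q = c \<cdot>\<^sub>m 1\<^sub>m n \<and> r = c \<cdot>\<^sub>m 1\<^sub>m d"
proof -
  obtain U0 dp0 where U0: "unitary_mat m U0" "mat_adjoint U0 * p * U0 = mat_diag m dp0"
    using hermitian_unitary_diagonalization[OF p] by blast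
  obtain V0 dq0 where V0: "unitary_mat n V0" "mat_adjoint V0 * q * V0 = mat_diag n dq0"
    using hermitian_unitary_diagonalization[OF q] by blast
  obtain W0 dr0 where W0: "unitary_mat d W0" "mat_adjoint W0 * r * W0 = mat_diag d dr0"
    using hermitian_unitary_diagonalization[OF r] by blast
  \<comment> \<open>Any eigenvalue of \<open>p\<close> would do.\<close>
  define c where "c = dp0 0"
  obtain U \<sigma> kp where U: "unitary_mat m U" and s: "\<sigma> permutes {..<m}" and kp: "kp \<le> m"
    and Up: "mat_adjoint U * p * U = mat_diag m (dp0 \<circ> \<sigma>)"
    and dp: "\<And>i. i < m \<Longrightarrow> dp0 (\<sigma> i) = c \<longleftrightarrow> i < kp"
    using sort_diagonalization[OF U0(1) p(1) U0(2), of "\<lambda>x. x = c"] by blast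
  obtain V \<sigma>q kq where V: "unitary_mat n V" and kq: "kq \<le> n"
    and Vq: "mat_adjoint V * q * V = mat_diag n (dq0 \<circ> \<sigma>q)"
    and dq: "\<And>i. i < n \<Longrightarrow> dq0 (\<sigma>q i) = c \<longleftrightarrow> i < kq"
    using sort_diagonalization[OF V0(1) q(1) V0(2), of "\<lambda>x. x = c"] by blast
  obtain W \<sigma>r kr where W: "unitary_mat d W" and kr: "kr \<le> d"
    and Wr: "mat_adjoint W * r * W = mat_diag d (dr0 \<circ> \<sigma>r)"
    and dr: "\<And>i. i < d \<Longrightarrow> dr0 (\<sigma>r i) = c \<longleftrightarrow> i < kr"
    using sort_diagonalization[OF W0(1) r(1) W0(2), of "\<lambda>x. x = c"] by blast
  note Uc = unitary_matD[OF U] and Vc = unitary_matD[OF V] and Wc = unitary_matD[OF W]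
  have B: "B \<in> carrier_mat m d" and A: "A \<in> carrier_mat m n" using rows cols by auto
  define Y where "Y = mat_adjoint U * B * W"
  define Z where "Z = mat_adjoint U * A * V"
  have Y: "Y \<in> carrier_mat m d" and Z: "Z \<in> carrier_mat m n"
    using Uc Vc Wc by (auto simp: Y_def Z_def)
  have Y0: "Y $$ (i, j) = 0" if "i < m" "j < d" "(i < kp) \<noteq> (j < kr)" for i j
    unfolding Y_def using that dp[of i] dr[of j]
    by (intro intertwined_entries[OF U W B p(1) r(1) pB Up Wr]) auto
  have Z0: "Z $$ (i, j) = 0" if "i < m" "j < n" "(i < kp) \<noteq> (j < kq)" for i j
    unfolding Z_def using that dp[of i] dq[of j]
    by (intro intertwined_entries[OF U V A p(1) q(1) pA Up Vq]) auto
  have row: "(\<exists>j<d. Y $$ (i, j) \<noteq> 0) \<or> (\<exists>j<n. Z $$ (i, j) \<noteq> 0)" if "i < m" for i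
    using component_core_row_nonzero[OF core, of U V W i] rows cols that U V W
    by (simp add: Y_def Z_def)
  have colB: "\<exists>i<m. Y $$ (i, j) \<noteq> 0" if "j < d" for j
    using component_core_col_nonzero(1)[OF core, of U V W j] rows cols that U V W
    by (simp add: Y_def)
  have colA: "\<exists>i<m. Z $$ (i, j) \<noteq> 0" if "j < n" for j
    using component_core_col_nonzero(2)[OF core, of U V W j] rows cols that U V W
    by (simp add: Z_def)
  \<comment> \<open>The index 0, where \<open>c\<close> was taken, is moved to a position in front of \<open>kp\<close>.\<close>
  obtain i0 where i0: "i0 < m" "\<sigma> i0 = 0"
    using permutes_image[OF s] m by (metis imageE lessThan_iff)
  have kp0: "0 < kp" using dp[OF i0(1)] i0(2) by (simp add: c_def)
  have full: "kp = m"
  proof (rule ccontr)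
    assume "kp \<noteq> m"
    then have kpm: "kp < m" using kp by simp
    have c1: "0 < kr + kq" using row[OF m]
    proof (elim disjE exE conjE)
      fix j assume "j < d" "Y $$ (0, j) \<noteq> 0"
      then show ?thesis using Y0[OF m, of j] kp0 by (cases "j < kr") auto
    next
      fix j assume "j < n" "Z $$ (0, j) \<noteq> 0"
      then show ?thesis using Z0[OF m, of j] kp0 by (cases "j < kq") auto
    qed
    have c2: "0 < (d - kr) + (n - kq)" using row[OF kpm]
    proof (elim disjE exE conjE)
      fix j assume "j < d" "Y $$ (kp, j) \<noteq> 0"
      then show ?thesis using Y0[OF kpm, of j] by (cases "j < kr") auto
    next
      fix j assume "j < n" "Z $$ (kp, j) \<noteq> 0"
      then show ?thesis using Z0[OF kpm, of j] by (cases "j < kq") auto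
    qed
    define cs where "cs =
      [(mat kp kr (\<lambda>ij. Y $$ ij), mat kp kq (\<lambda>ij. Z $$ ij)),
       (mat (m - kp) (d - kr) (\<lambda>(i, j). Y $$ (i + kp, j + kr)),
        mat (m - kp) (n - kq) (\<lambda>(i, j). Z $$ (i + kp, j + kq)))]"
    have "Y = diag_block_mat (map fst cs)"
      using Y Y0 kp kr by (intro eq_matI) (auto simp: cs_def Let_def)
    moreover have "Z = diag_block_mat (map snd cs)"
      using Z Z0 kp kq by (intro eq_matI) (auto simp: cs_def Let_def)
    ultimately have "reduced_structure B A U V W cs"
      unfolding reduced_structure_def Y_def Z_def using U V W rows cols kp0 kpm c1 c2
      by (simp add: cs_def)
    then have "reducible B A" unfolding reducible_def
      by (intro exI[of _ U] exI[of _ V] exI[of _ W] exI[of _ cs]) (simp add: cs_def)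
    then show False using irr by simp
  qed
  have "kq = n"
  proof (rule ccontr)
    assume "kq \<noteq> n"
    then have "kq < n" using kq by simp
    then show False using colA[of kq] Z0[of _ kq] full by auto
  qed
  moreover have "kr = d"
  proof (rule ccontr)
    assume "kr \<noteq> d"
    then have "kr < d" using kr by simp
    then show False using colB[of kr] Y0[of _ kr] full by auto
  qed
  ultimately show ?thesis
    using scalar_of_diag[OF U p(1) Up, of c] scalar_of_diag[OF V q(1) Vq, of c]
      scalar_of_diag[OF W r(1) Wr, of c] dp dq dr full by auto
qed

section \<open>The squared Frobenius norm\<close>

definition frob_sq :: "complex mat \<Rightarrow> real" where
  "frob_sq X = (\<Sum>j<dim_col X. \<Sum>i<dim_row X. (cmod (X $$ (i, j)))\<^sup>2)"

lemma frob_sq_nonneg: "0 \<le> frob_sq X"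
  unfolding frob_sq_def by (intro sum_nonneg) auto

lemma frob_sq_adjoint: "frob_sq (mat_adjoint X) = frob_sq X"
  unfolding frob_sq_def by (subst sum.swap) simp

lemma frob_sq_gram: "complex_of_real (frob_sq X) = (\<Sum>j<dim_col X. (mat_adjoint X * X) $$ (j, j))"
  by (simp add: frob_sq_def scalar_prod_def atLeast0LessThan complex_norm_square mult.commute
      del: of_real_power)

lemma frob_sq_isometry:
  assumes "mat_adjoint U * U = 1\<^sub>m k" "dim_col U = k" "dim_row X = k"
  shows "frob_sq (U * X) = frob_sq X"
proof -
  have "mat_adjoint (U * X) * (U * X) = mat_adjoint X * ((mat_adjoint U * U) * X)"
    using assms(2,3) by (simp add: dim_simps)
  also have "\<dots> = mat_adjoint X * X"
    unfolding assms(1) using assms(3) by (simp add: mult_one_dim)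
  finally have "complex_of_real (frob_sq (U * X)) = complex_of_real (frob_sq X)"
    by (simp only: frob_sq_gram) simp
  then show ?thesis by (simp only: of_real_eq_iff)
qed

lemma frob_sq_of_scalar_gram:
  assumes "mat_adjoint X * X = c \<cdot>\<^sub>m 1\<^sub>m n" "dim_col X = n"
  shows "complex_of_real (frob_sq X) = of_nat n * c"
  unfolding frob_sq_gram assms by simp

section \<open>Intertwiners and Schur's lemma\<close>

type_synonym mat_pair = "complex mat \<times> complex mat"

definition wf_pair :: "mat_pair \<Rightarrow> bool" where
  "wf_pair x \<longleftrightarrow> dim_row (fst x) = dim_row (snd x)"

text \<open>
  The relation between components in the theorem. It acts on pairs so that its equivalence classes
  can be counted.
\<close>
definition unitarily_equiv :: "mat_pair \<Rightarrow> mat_pair \<Rightarrow> bool" where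
  "unitarily_equiv x y \<longleftrightarrow> (\<exists>Pt Qt Rt.
     unitary_mat (dim_row (snd x)) Pt \<and> unitary_mat (dim_col (snd x)) Qt \<and>
     unitary_mat (dim_col (fst x)) Rt \<and>
     mat_adjoint Pt * fst x * Rt = fst y \<and> mat_adjoint Pt * snd x * Qt = snd y)"

lemma unitarily_equiv_refl: "wf_pair x \<Longrightarrow> unitarily_equiv x x"
  unfolding unitarily_equiv_def wf_pair_def
  by (intro exI[of _ "1\<^sub>m (dim_row (snd x))"] exI[of _ "1\<^sub>m (dim_col (snd x))"]
      exI[of _ "1\<^sub>m (dim_col (fst x))"]) (simp add: unitary_mat_one mult_one_dim)

lemma unitarily_equiv_sym:
  assumes "wf_pair x" "unitarily_equiv x y"
  shows "unitarily_equiv y x"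
proof -
  obtain P Q R where U: "unitary_mat (dim_row (snd x)) P" "unitary_mat (dim_col (snd x)) Q"
     "unitary_mat (dim_col (fst x)) R"
     and e: "fst y = mat_adjoint P * fst x * R" "snd y = mat_adjoint P * snd x * Q"
    using assms(2) unfolding unitarily_equiv_def by metis
  note c = unitary_matD(2,3,5)[OF U(1)] unitary_matD(2,3,5)[OF U(2)] unitary_matD(2,3,5)[OF U(3)]
  show ?thesis unfolding unitarily_equiv_def
    using U c assms(1)
    by (intro exI[of _ "mat_adjoint P"] exI[of _ "mat_adjoint Q"] exI[of _ "mat_adjoint R"])
      (simp add: e unitary_mat_adjoint dim_simps unitary_cancel[OF U(1)] wf_pair_def)
qed

lemma unitarily_equiv_trans:
  assumes "wf_pair x" "unitarily_equiv x y" "unitarily_equiv y z"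
  shows "unitarily_equiv x z"
proof -
  obtain P Q R where U: "unitary_mat (dim_row (snd x)) P" "unitary_mat (dim_col (snd x)) Q"
     "unitary_mat (dim_col (fst x)) R"
     and e: "fst y = mat_adjoint P * fst x * R" "snd y = mat_adjoint P * snd x * Q"
    using assms(2) unfolding unitarily_equiv_def by metis
  obtain P' Q' R' where U': "unitary_mat (dim_row (snd y)) P'" "unitary_mat (dim_col (snd y)) Q'"
     "unitary_mat (dim_col (fst y)) R'"
     and e': "fst z = mat_adjoint P' * fst y * R'" "snd z = mat_adjoint P' * snd y * Q'"
    using assms(3) unfolding unitarily_equiv_def by metis
  note c = unitary_matD(2,3)[OF U(1)] unitary_matD(2,3)[OF U(2)] unitary_matD(2,3)[OF U(3)]
  have d: "dim_row (snd y) = dim_row (snd x)" "dim_col (snd y) = dim_col (snd x)"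
    "dim_col (fst y) = dim_col (fst x)" using c by (simp_all add: e)
  note U' = U'[unfolded d]
  note c' = unitary_matD(2,3)[OF U'(1)] unitary_matD(2,3)[OF U'(2)] unitary_matD(2,3)[OF U'(3)]
  show ?thesis unfolding unitarily_equiv_def
    using U U' c c' assms(1)
    by (intro exI[of _ "P * P'"] exI[of _ "Q * Q'"] exI[of _ "R * R'"])
      (simp add: e e' unitary_mat_mult dim_simps wf_pair_def)
qed

text \<open>
  A triple of maps between the row space, the \<open>A\<close>-column space and the \<open>B\<close>-column space, which
  commutes with the two matrices and with their adjoints. Commuting with the adjoints expresses that
  the decompositions considered here are orthogonal: it makes the adjoint of an intertwiner an
  intertwiner again.
\<close>
definition intertwiner ::
  "mat_pair \<Rightarrow> mat_pair \<Rightarrow> complex mat \<Rightarrow> complex mat \<Rightarrow> complex mat \<Rightarrow> bool" where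
  "intertwiner x y p q r \<longleftrightarrow>
     dim_row p = dim_row (snd y) \<and> dim_col p = dim_row (snd x) \<and>
     dim_row q = dim_col (snd y) \<and> dim_col q = dim_col (snd x) \<and>
     dim_row r = dim_col (fst y) \<and> dim_col r = dim_col (fst x) \<and>
     p * fst x = fst y * r \<and> p * snd x = snd y * q \<and>
     r * mat_adjoint (fst x) = mat_adjoint (fst y) * p \<and>
     q * mat_adjoint (snd x) = mat_adjoint (snd y) * p"

lemma intertwinerD:
  assumes "intertwiner x y p q r"
  shows "dim_row p = dim_row (snd y)" "dim_col p = dim_row (snd x)"
    "dim_row q = dim_col (snd y)" "dim_col q = dim_col (snd x)"
    "dim_row r = dim_col (fst y)" "dim_col r = dim_col (fst x)"
    "p * fst x = fst y * r" "p * snd x = snd y * q"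
    "r * mat_adjoint (fst x) = mat_adjoint (fst y) * p"
    "q * mat_adjoint (snd x) = mat_adjoint (snd y) * p"
  using assms by (auto simp: intertwiner_def)

lemma intertwiner_adjoint:
  assumes x: "wf_pair x" and y: "wf_pair y" and i: "intertwiner x y p q r"
  shows "intertwiner y x (mat_adjoint p) (mat_adjoint q) (mat_adjoint r)"
proof -
  note D = intertwinerD[OF i]
  have "mat_adjoint p * fst y = fst x * mat_adjoint r" "mat_adjoint p * snd y = snd x * mat_adjoint q"
    "mat_adjoint r * mat_adjoint (fst y) = mat_adjoint (fst x) * mat_adjoint p"
    "mat_adjoint q * mat_adjoint (snd y) = mat_adjoint (snd x) * mat_adjoint p"
    using arg_cong[OF D(9), of mat_adjoint] arg_cong[OF D(10), of mat_adjoint]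
      arg_cong[OF D(7), of mat_adjoint] arg_cong[OF D(8), of mat_adjoint] D(1-6) x y
    by (simp_all add: mat_adjoint_mult_dim wf_pair_def)
  then show ?thesis using D(1-6) by (simp add: intertwiner_def)
qed

lemma intertwiner_comp:
  assumes x: "wf_pair x" and y: "wf_pair y" and z: "wf_pair z"
    and i: "intertwiner x y p q r" and j: "intertwiner y z p' q' r'"
  shows "intertwiner x z (p' * p) (q' * q) (r' * r)"
proof -
  note D = intertwinerD[OF i] and E = intertwinerD[OF j]
  have "p' * p * fst x = p' * fst y * r"
    using x y D E(1-6) by (simp add: wf_pair_def mult_assoc_dim)
  also have "\<dots> = fst z * (r' * r)"
    unfolding E(7) using z D(1-6) E(1-6) by (simp add: mult_assoc_dim)
  finally have 1: "p' * p * fst x = fst z * (r' * r)" .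
  have "p' * p * snd x = p' * snd y * q"
    using x y D E(1-6) by (simp add: mult_assoc_dim)
  also have "\<dots> = snd z * (q' * q)"
    unfolding E(8) using z D(1-6) E(1-6) by (simp add: mult_assoc_dim)
  finally have 2: "p' * p * snd x = snd z * (q' * q)" .
  have "r' * r * mat_adjoint (fst x) = r' * mat_adjoint (fst y) * p"
    using x y D E(1-6) by (simp add: wf_pair_def mult_assoc_dim)
  also have "\<dots> = mat_adjoint (fst z) * (p' * p)"
    unfolding E(9) using z D(1-6) E(1-6) by (simp add: wf_pair_def mult_assoc_dim)
  finally have 3: "r' * r * mat_adjoint (fst x) = mat_adjoint (fst z) * (p' * p)" .
  have "q' * q * mat_adjoint (snd x) = q' * mat_adjoint (snd y) * p"
    using x y D E(1-6) by (simp add: mult_assoc_dim)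
  also have "\<dots> = mat_adjoint (snd z) * (p' * p)"
    unfolding E(10) using z D(1-6) E(1-6) by (simp add: mult_assoc_dim)
  finally have 4: "q' * q * mat_adjoint (snd x) = mat_adjoint (snd z) * (p' * p)" .
  show ?thesis unfolding intertwiner_def using 1 2 3 4 D(1-6) E(1-6) by simp
qed

definition irreducible_core :: "mat_pair \<Rightarrow> bool" where
  "irreducible_core x \<longleftrightarrow> wf_pair x \<and> 0 < dim_row (snd x) \<and>
     component_core_problem (fst x) (snd x) \<and> \<not> reducible (fst x) (snd x)"

text \<open>
  Schur's lemma. The triple \<open>(p\<^sup>* p, q\<^sup>* q, r\<^sup>* r)\<close> is a Hermitian endomorphism of \<open>x\<close>, so it is
  one scalar \<open>c\<close>, shared by all three spaces.
\<close>
lemma intertwiner_gram_scalar: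
  assumes x: "irreducible_core x" and y: "wf_pair y" and i: "intertwiner x y p q r"
  shows "\<exists>c. mat_adjoint p * p = c \<cdot>\<^sub>m 1\<^sub>m (dim_row (snd x)) \<and>
    mat_adjoint q * q = c \<cdot>\<^sub>m 1\<^sub>m (dim_col (snd x)) \<and>
    mat_adjoint r * r = c \<cdot>\<^sub>m 1\<^sub>m (dim_col (fst x))"
proof -
  have wx: "wf_pair x" using x by (simp add: irreducible_core_def)
  note D = intertwinerD[OF i]
  note I = intertwinerD[OF intertwiner_comp[OF wx y wx i intertwiner_adjoint[OF wx y i]]]
  show ?thesis
    by (rule hermitian_endomorphism_scalar[of "fst x" "snd x"])
      (use x D(1-6) I(7,8) in \<open>auto simp: irreducible_core_def wf_pair_def mat_adjoint_mult_dim\<close>)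
qed

lemma unitary_normalization:
  assumes "mat_adjoint p * p = complex_of_real s \<cdot>\<^sub>m 1\<^sub>m n" "p \<in> carrier_mat n n" "0 < s"
  shows "unitary_mat n (complex_of_real (1 / sqrt s) \<cdot>\<^sub>m p)"
proof (rule unitary_matI)
  have "complex_of_real (1 / sqrt s) * (complex_of_real (1 / sqrt s) * complex_of_real s) = 1"
    using assms(3) by (simp flip: of_real_mult)
  then show "mat_adjoint (complex_of_real (1 / sqrt s) \<cdot>\<^sub>m p) * (complex_of_real (1 / sqrt s) \<cdot>\<^sub>m p) = 1\<^sub>m n"
    using assms(2) by (intro eq_matI) (auto simp: mat_adjoint_smult smult_mult_dim assms(1))
qed (use assms in simp)

text \<open>
  Schur's lemma on both sides gives \<open>p\<^sup>* p = c\<close> and \<open>p p\<^sup>* = c'\<close>, and \<open>p p\<^sup>* p\<close> shows \<open>c = c'\<close>.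
  The trace of \<open>p\<^sup>* p\<close> equals that of \<open>p p\<^sup>*\<close>, so the dimensions of \<open>x\<close> and \<open>y\<close> agree and \<open>p\<close>, \<open>q\<close>
  and \<open>r\<close> are multiples of unitary matrices by the common factor \<open>sqrt c\<close>.
\<close>
lemma nonzero_intertwiner_equiv:
  assumes x: "irreducible_core x" and y: "irreducible_core y"
    and i: "intertwiner x y p q r" and nz: "frob_sq p \<noteq> 0"
  shows "unitarily_equiv x y \<and> dim_row (snd x) = dim_row (snd y)"
proof -
  have wx: "wf_pair x" and wy: "wf_pair y" using x y by (simp_all add: irreducible_core_def)
  note D = intertwinerD[OF i]
  obtain c where c: "mat_adjoint p * p = c \<cdot>\<^sub>m 1\<^sub>m (dim_row (snd x))"
    "mat_adjoint q * q = c \<cdot>\<^sub>m 1\<^sub>m (dim_col (snd x))" "mat_adjoint r * r = c \<cdot>\<^sub>m 1\<^sub>m (dim_col (fst x))"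
    using intertwiner_gram_scalar[OF x wy i] by blast
  obtain c' where c': "p * mat_adjoint p = c' \<cdot>\<^sub>m 1\<^sub>m (dim_row (snd y))"
    "q * mat_adjoint q = c' \<cdot>\<^sub>m 1\<^sub>m (dim_col (snd y))" "r * mat_adjoint r = c' \<cdot>\<^sub>m 1\<^sub>m (dim_col (fst y))"
    using intertwiner_gram_scalar[OF y wx intertwiner_adjoint[OF wx wy i]] by auto
  obtain a b where ab: "a < dim_row p" "b < dim_col p" "p $$ (a, b) \<noteq> 0"
    using nz unfolding frob_sq_def by (metis (no_types, lifting) lessThan_iff norm_zero power_zero_numeral sum.neutral)
  have "c' \<cdot>\<^sub>m p = p * mat_adjoint p * p"
    unfolding c' using D(1) by (simp add: smult_mult_dim mult_one_dim)
  also have "\<dots> = p * (mat_adjoint p * p)" by (simp add: mult_assoc_dim)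
  also have "\<dots> = c \<cdot>\<^sub>m p"
    unfolding c using D(2) by (simp add: smult_mult_dim mult_one_dim)
  finally have "(c' \<cdot>\<^sub>m p) $$ (a, b) = (c \<cdot>\<^sub>m p) $$ (a, b)" by simp
  then have cc: "c' = c" using ab by simp
  note c' = c'[unfolded cc]
  have fx: "complex_of_real (frob_sq p) = of_nat (dim_row (snd x)) * c"
    "complex_of_real (frob_sq q) = of_nat (dim_col (snd x)) * c"
    "complex_of_real (frob_sq r) = of_nat (dim_col (fst x)) * c"
    using c D(1-6) by (auto intro!: frob_sq_of_scalar_gram)
  have fy: "complex_of_real (frob_sq p) = of_nat (dim_row (snd y)) * c"
    "complex_of_real (frob_sq q) = of_nat (dim_col (snd y)) * c"
    "complex_of_real (frob_sq r) = of_nat (dim_col (fst y)) * c"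
    using frob_sq_of_scalar_gram[of "mat_adjoint p"] frob_sq_of_scalar_gram[of "mat_adjoint q"]
      frob_sq_of_scalar_gram[of "mat_adjoint r"] c' D(1-6) by (simp_all add: frob_sq_adjoint)
  have c0: "c \<noteq> 0" using fx(1) nz by auto
  have dims: "dim_row (snd y) = dim_row (snd x)" "dim_col (snd y) = dim_col (snd x)"
    "dim_col (fst y) = dim_col (fst x)"
    using fx fy c0 by simp_all
  define s where "s = frob_sq p / real (dim_row (snd x))"
  have m: "0 < dim_row (snd x)" using x by (simp add: irreducible_core_def)
  have s0: "0 < s" using nz frob_sq_nonneg[of p] m by (simp add: s_def)
  have cs: "c = complex_of_real s"
    unfolding s_def of_real_divide fx(1) using m by simp
  define k where "k = complex_of_real (1 / sqrt s)"
  have kk: "k * (k * c) = 1" and ck: "cnj k = k"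
    using s0 by (simp_all add: k_def cs flip: of_real_mult)
  have carr: "mat_adjoint p \<in> carrier_mat (dim_row (snd x)) (dim_row (snd x))"
    "mat_adjoint q \<in> carrier_mat (dim_col (snd x)) (dim_col (snd x))"
    "mat_adjoint r \<in> carrier_mat (dim_col (fst x)) (dim_col (fst x))"
    using D(1-6) dims by (simp_all only: carrier_mat_def mem_Collect_eq dim_mat_adjoint simp_thms)
  note cy = c'[unfolded dims cs]
  have U: "unitary_mat (dim_row (snd x)) (k \<cdot>\<^sub>m mat_adjoint p)"
    "unitary_mat (dim_col (snd x)) (k \<cdot>\<^sub>m mat_adjoint q)"
    "unitary_mat (dim_col (fst x)) (k \<cdot>\<^sub>m mat_adjoint r)"
    unfolding k_def
    using unitary_normalization[OF _ carr(1) s0] unitary_normalization[OF _ carr(2) s0]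
      unitary_normalization[OF _ carr(3) s0] cy
    by (simp_all only: mat_adjoint_adjoint)
  have "mat_adjoint (k \<cdot>\<^sub>m mat_adjoint p) * fst x * (k \<cdot>\<^sub>m mat_adjoint r) =
      k \<cdot>\<^sub>m (k \<cdot>\<^sub>m (p * fst x * mat_adjoint r))"
    using D(1-6) wx by (simp add: mat_adjoint_smult ck smult_mult_dim wf_pair_def)
  also have "p * fst x * mat_adjoint r = fst y * (r * mat_adjoint r)"
    unfolding D(7) using D(1-6) by (simp add: mult_assoc_dim)
  also have "\<dots> = c \<cdot>\<^sub>m fst y" unfolding c' by (simp add: smult_mult_dim mult_one_dim)
  also have "k \<cdot>\<^sub>m (k \<cdot>\<^sub>m (c \<cdot>\<^sub>m fst y)) = fst y"
    using kk by (intro eq_matI) (auto simp flip: mult.assoc)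
  finally have 1: "mat_adjoint (k \<cdot>\<^sub>m mat_adjoint p) * fst x * (k \<cdot>\<^sub>m mat_adjoint r) = fst y" .
  have "mat_adjoint (k \<cdot>\<^sub>m mat_adjoint p) * snd x * (k \<cdot>\<^sub>m mat_adjoint q) =
      k \<cdot>\<^sub>m (k \<cdot>\<^sub>m (p * snd x * mat_adjoint q))"
    using D(1-6) wx by (simp add: mat_adjoint_smult ck smult_mult_dim)
  also have "p * snd x * mat_adjoint q = snd y * (q * mat_adjoint q)"
    unfolding D(8) using D(1-6) by (simp add: mult_assoc_dim)
  also have "\<dots> = c \<cdot>\<^sub>m snd y" unfolding c' by (simp add: smult_mult_dim mult_one_dim)
  also have "k \<cdot>\<^sub>m (k \<cdot>\<^sub>m (c \<cdot>\<^sub>m snd y)) = snd y"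
    using kk by (intro eq_matI) (auto simp flip: mult.assoc)
  finally have 2: "mat_adjoint (k \<cdot>\<^sub>m mat_adjoint p) * snd x * (k \<cdot>\<^sub>m mat_adjoint q) = snd y" .
  show ?thesis unfolding unitarily_equiv_def using U 1 2 dims by metis
qed

section \<open>Reduced structures as orthogonal sums\<close>

definition incl_fst :: "nat \<Rightarrow> nat \<Rightarrow> complex mat" where
  "incl_fst a b = mat (a + b) a (\<lambda>(i, j). if i = j then 1 else 0)"

definition incl_snd :: "nat \<Rightarrow> nat \<Rightarrow> complex mat" where
  "incl_snd a b = mat (a + b) b (\<lambda>(i, j). if i = a + j then 1 else 0)"

lemma dim_incl[simp]:
  "dim_row (incl_fst a b) = a + b" "dim_col (incl_fst a b) = a"
  "dim_row (incl_snd a b) = a + b" "dim_col (incl_snd a b) = b"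
  by (simp_all add: incl_fst_def incl_snd_def)

lemma index_mult_incl:
  assumes "dim_col X = a + b" "i < dim_row X"
  shows "j < a \<Longrightarrow> (X * incl_fst a b) $$ (i, j) = X $$ (i, j)"
    and "j < b \<Longrightarrow> (X * incl_snd a b) $$ (i, j) = X $$ (i, a + j)"
  using assms by (simp_all add: incl_fst_def incl_snd_def scalar_prod_def if_distrib[of "\<lambda>x. _ * x"] cong: if_cong)

lemma index_incl_mult:
  assumes "i < a + b" "j < dim_col X"
  shows "dim_row X = a \<Longrightarrow> (incl_fst a b * X) $$ (i, j) = (if i < a then X $$ (i, j) else 0)"
    and "dim_row X = b \<Longrightarrow> (incl_snd a b * X) $$ (i, j) = (if i < a then 0 else X $$ (i - a, j))"
proof -
  show "(incl_fst a b * X) $$ (i, j) = (if i < a then X $$ (i, j) else 0)" if "dim_row X = a"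
    using that assms
    by (simp add: incl_fst_def scalar_prod_def if_distrib[of "\<lambda>x. x * _"] cong: if_cong)
  have e: "i = a + k \<longleftrightarrow> \<not> i < a \<and> k = i - a" for k by auto
  show "(incl_snd a b * X) $$ (i, j) = (if i < a then 0 else X $$ (i - a, j))" if "dim_row X = b"
    using that assms
    by (auto simp: incl_snd_def scalar_prod_def e if_distrib[of "\<lambda>x. x * _"] cong: if_cong)
qed

lemma index_incl_adjoint_mult:
  assumes "dim_row X = a + b" "j < dim_col X"
  shows "i < a \<Longrightarrow> (mat_adjoint (incl_fst a b) * X) $$ (i, j) = X $$ (i, j)"
    and "i < b \<Longrightarrow> (mat_adjoint (incl_snd a b) * X) $$ (i, j) = X $$ (a + i, j)"
  using assms by (simp_all add: incl_fst_def incl_snd_def scalar_prod_def if_distrib[of "\<lambda>x. x * _"]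
      if_distrib[of cnj] cong: if_cong)

lemma incl_isometry:
  "mat_adjoint (incl_fst a b) * incl_fst a b = 1\<^sub>m a"
  "mat_adjoint (incl_snd a b) * incl_snd a b = 1\<^sub>m b"
  by (intro eq_matI; simp add: index_incl_adjoint_mult del: index_mult_mat(1);
      simp add: incl_fst_def incl_snd_def)+

lemma incl_parseval:
  assumes "dim_row X = a + b"
  shows "frob_sq (mat_adjoint (incl_fst a b) * X) + frob_sq (mat_adjoint (incl_snd a b) * X) = frob_sq X"
proof -
  have "(\<Sum>i<a + b. f i) = (\<Sum>i<a. f i) + (\<Sum>i<b. f (a + i))" for f :: "nat \<Rightarrow> real"
    by (induction b) (auto simp: ac_simps)
  then show ?thesis
    using assms by (simp add: frob_sq_def index_incl_adjoint_mult sum.distrib del: index_mult_mat(1))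
qed

lemma four_block_incl:
  fixes X Y :: "complex mat"
  defines "D \<equiv> four_block_mat X (0\<^sub>m (dim_row X) (dim_col Y)) (0\<^sub>m (dim_row Y) (dim_col X)) Y"
  shows "incl_fst (dim_row X) (dim_row Y) * X = D * incl_fst (dim_col X) (dim_col Y)"
    and "incl_snd (dim_row X) (dim_row Y) * Y = D * incl_snd (dim_col X) (dim_col Y)"
  by (intro eq_matI; simp add: index_mult_incl index_incl_mult D_def del: index_mult_mat(1))+

text \<open>
  The inclusions of the two summands of a block diagonal pair commute with the adjoints as well, since
  the adjoint of a block diagonal matrix is again block diagonal.
\<close>
lemma four_block_intertwiners:
  fixes B0 A0 B1 A1 :: "complex mat"
  assumes "wf_pair (B0, A0)" "wf_pair (B1, A1)"
  defines "D X Y \<equiv> four_block_mat X (0\<^sub>m (dim_row X) (dim_col Y)) (0\<^sub>m (dim_row Y) (dim_col X)) (Y :: complex mat)"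
  shows "intertwiner (B0, A0) (D B0 B1, D A0 A1) (incl_fst (dim_row A0) (dim_row A1))
      (incl_fst (dim_col A0) (dim_col A1)) (incl_fst (dim_col B0) (dim_col B1))"
    and "intertwiner (B1, A1) (D B0 B1, D A0 A1) (incl_snd (dim_row A0) (dim_row A1))
      (incl_snd (dim_col A0) (dim_col A1)) (incl_snd (dim_col B0) (dim_col B1))"
proof -
  have adj: "mat_adjoint (D X Y) = D (mat_adjoint X) (mat_adjoint Y)" for X Y
    unfolding D_def by (subst mat_adjoint_four_block) auto
  have d: "dim_row (D X Y) = dim_row X + dim_row Y" "dim_col (D X Y) = dim_col X + dim_col Y" for X Y
    by (simp_all add: D_def)
  show "intertwiner (B0, A0) (D B0 B1, D A0 A1) (incl_fst (dim_row A0) (dim_row A1))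
      (incl_fst (dim_col A0) (dim_col A1)) (incl_fst (dim_col B0) (dim_col B1))"
    unfolding intertwiner_def fst_conv snd_conv adj
    using four_block_incl(1)[of B0 B1, folded D_def] four_block_incl(1)[of A0 A1, folded D_def]
      four_block_incl(1)[of "mat_adjoint B0" "mat_adjoint B1", folded D_def]
      four_block_incl(1)[of "mat_adjoint A0" "mat_adjoint A1", folded D_def] assms(1,2)
    by (simp add: d wf_pair_def)
  show "intertwiner (B1, A1) (D B0 B1, D A0 A1) (incl_snd (dim_row A0) (dim_row A1))
      (incl_snd (dim_col A0) (dim_col A1)) (incl_snd (dim_col B0) (dim_col B1))"
    unfolding intertwiner_def fst_conv snd_conv adj
    using four_block_incl(2)[of B0 B1, folded D_def] four_block_incl(2)[of A0 A1, folded D_def]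
      four_block_incl(2)[of "mat_adjoint B0" "mat_adjoint B1", folded D_def]
      four_block_incl(2)[of "mat_adjoint A0" "mat_adjoint A1", folded D_def] assms(1,2)
    by (simp add: d wf_pair_def)
qed

definition diag_pair :: "mat_pair list \<Rightarrow> mat_pair" where
  "diag_pair cs = (diag_block_mat (map fst cs), diag_block_mat (map snd cs))"

lemma wf_diag_pair: "(\<And>x. x \<in> set cs \<Longrightarrow> wf_pair x) \<Longrightarrow> wf_pair (diag_pair cs)"
  by (simp add: wf_pair_def diag_pair_def dim_diag_block_mat o_def cong: map_cong)

text \<open>
  \<open>y\<close> is the internal orthogonal sum of isometric copies of the members of \<open>cs\<close>. That the row spaces
  of the copies are mutually orthogonal and exhaust that of \<open>y\<close> is encoded by Parseval's identity for
  the coordinate maps \<open>(E t)\<^sup>*\<close>, the form in which it is used.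
\<close>
definition orthogonal_sum :: "mat_pair list \<Rightarrow> mat_pair \<Rightarrow>
  (nat \<Rightarrow> complex mat) \<Rightarrow> (nat \<Rightarrow> complex mat) \<Rightarrow> (nat \<Rightarrow> complex mat) \<Rightarrow> bool" where
  "orthogonal_sum cs y E F G \<longleftrightarrow>
     (\<forall>t<length cs. intertwiner (cs ! t) y (E t) (F t) (G t) \<and>
        mat_adjoint (E t) * E t = 1\<^sub>m (dim_row (snd (cs ! t)))) \<and>
     (\<forall>X. dim_row X = dim_row (snd y) \<longrightarrow>
        (\<Sum>t<length cs. frob_sq (mat_adjoint (E t) * X)) = frob_sq X)"

lemma diag_pair_orthogonal_sum:
  assumes "\<And>x. x \<in> set cs \<Longrightarrow> wf_pair x"
  shows "\<exists>E F G. orthogonal_sum cs (diag_pair cs) E F G"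
  using assms
proof (induction cs)
  case Nil
  then show ?case by (simp add: orthogonal_sum_def diag_pair_def frob_sq_def)
next
  case (Cons x cs)
  obtain B0 A0 where x: "x = (B0, A0)" by (cases x)
  obtain B1 A1 where y: "diag_pair cs = (B1, A1)" by (cases "diag_pair cs")
  have wx: "wf_pair (B0, A0)" using Cons.prems x by simp
  have wy: "wf_pair (B1, A1)" using wf_diag_pair[of cs] Cons.prems y by simp
  have wz: "wf_pair (diag_pair (x # cs))" using wf_diag_pair[of "x # cs"] Cons.prems by simp
  have z: "diag_pair (x # cs) =
    (four_block_mat B0 (0\<^sub>m (dim_row B0) (dim_col B1)) (0\<^sub>m (dim_row B1) (dim_col B0)) B1,
     four_block_mat A0 (0\<^sub>m (dim_row A0) (dim_col A1)) (0\<^sub>m (dim_row A1) (dim_col A0)) A1)"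
    using y by (simp add: diag_pair_def x Let_def)
  note I = four_block_intertwiners[OF wx wy, folded z]
  from Cons obtain E F G where "orthogonal_sum cs (B1, A1) E F G" unfolding y by auto
  then have EI: "\<And>t. t < length cs \<Longrightarrow> intertwiner (cs ! t) (B1, A1) (E t) (F t) (G t)"
    and EE: "\<And>t. t < length cs \<Longrightarrow> mat_adjoint (E t) * E t = 1\<^sub>m (dim_row (snd (cs ! t)))"
    and EP: "\<And>X. dim_row X = dim_row A1 \<Longrightarrow> (\<Sum>t<length cs. frob_sq (mat_adjoint (E t) * X)) = frob_sq X"
    by (auto simp: orthogonal_sum_def)
  define i1 where "i1 = incl_fst (dim_row A0) (dim_row A1)"
  define i2 where "i2 = incl_snd (dim_row A0) (dim_row A1)"
  define E' where "E' t = (case t of 0 \<Rightarrow> i1 | Suc s \<Rightarrow> i2 * E s)" for t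
  define F' where "F' t = (case t of 0 \<Rightarrow> incl_fst (dim_col A0) (dim_col A1)
    | Suc s \<Rightarrow> incl_snd (dim_col A0) (dim_col A1) * F s)" for t
  define G' where "G' t = (case t of 0 \<Rightarrow> incl_fst (dim_col B0) (dim_col B1)
    | Suc s \<Rightarrow> incl_snd (dim_col B0) (dim_col B1) * G s)" for t
  have "intertwiner ((x # cs) ! t) (diag_pair (x # cs)) (E' t) (F' t) (G' t) \<and>
      mat_adjoint (E' t) * E' t = 1\<^sub>m (dim_row (snd ((x # cs) ! t)))" if t: "t < length (x # cs)" for t
  proof (cases t)
    case 0
    then show ?thesis using I(1) incl_isometry(1) by (simp add: E'_def F'_def G'_def x i1_def)
  next
    case (Suc s)
    then have s: "s < length cs" using t by simp
    have "intertwiner (cs ! s) (diag_pair (x # cs)) (E' t) (F' t) (G' t)"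
      using intertwiner_comp[OF _ wy wz EI[OF s] I(2)] Cons.prems s
      by (simp add: E'_def F'_def G'_def Suc i2_def)
    moreover have "mat_adjoint (i2 * E s) * (i2 * E s) = mat_adjoint (E s) * ((mat_adjoint i2 * i2) * E s)"
      using intertwinerD(1,2)[OF EI[OF s]] by (simp add: dim_simps i2_def)
    then have "mat_adjoint (i2 * E s) * (i2 * E s) = 1\<^sub>m (dim_row (snd (cs ! s)))"
      unfolding i2_def incl_isometry using intertwinerD(1,2)[OF EI[OF s]] EE[OF s]
      by (simp add: mult_one_dim)
    ultimately show ?thesis by (simp add: E'_def Suc)
  qed
  moreover have "(\<Sum>t<length (x # cs). frob_sq (mat_adjoint (E' t) * X)) = frob_sq X"
    if X: "dim_row X = dim_row (snd (diag_pair (x # cs)))" for X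
  proof -
    have X': "dim_row X = dim_row A0 + dim_row A1" using X by (simp add: z)
    have "mat_adjoint (E' (Suc t)) * X = mat_adjoint (E t) * (mat_adjoint i2 * X)" if "t < length cs" for t
      using intertwinerD(1,2)[OF EI[OF that]] X' by (simp add: E'_def dim_simps i2_def)
    then have "(\<Sum>t<length (x # cs). frob_sq (mat_adjoint (E' t) * X)) =
      frob_sq (mat_adjoint i1 * X) + (\<Sum>t<length cs. frob_sq (mat_adjoint (E t) * (mat_adjoint i2 * X)))"
      by (simp add: sum.lessThan_Suc_shift E'_def del: sum.lessThan_Suc)
    also have "\<dots> = frob_sq (mat_adjoint i1 * X) + frob_sq (mat_adjoint i2 * X)"
      by (subst EP) (simp_all add: i2_def)
    also have "\<dots> = frob_sq X" unfolding i1_def i2_def by (rule incl_parseval[OF X'])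
    finally show ?thesis .
  qed
  ultimately have "orthogonal_sum (x # cs) (diag_pair (x # cs)) E' F' G'"
    unfolding orthogonal_sum_def by blast
  then show ?case by blast
qed

lemma reduced_structure_orthogonal_sum:
  assumes rs: "reduced_structure B A P Q R cs"
  shows "\<exists>E F G. orthogonal_sum cs (B, A) E F G"
proof -
  have w: "\<And>x. x \<in> set cs \<Longrightarrow> wf_pair x" using rs by (auto simp: reduced_structure_def wf_pair_def)
  have rows: "dim_row B = dim_row A" and U: "unitary_mat (dim_row A) P" "unitary_mat (dim_col A) Q"
    "unitary_mat (dim_col B) R"
    and D: "diag_pair cs = (mat_adjoint P * B * R, mat_adjoint P * A * Q)"
    using rs by (auto simp: reduced_structure_def diag_pair_def)
  note Pc = unitary_matD[OF U(1)] and Qc = unitary_matD[OF U(2)] and Rc = unitary_matD[OF U(3)]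
  have wy: "wf_pair (B, A)" using rows by (simp add: wf_pair_def)
  have I: "intertwiner (diag_pair cs) (B, A) P Q R"
    unfolding D intertwiner_def using Pc(2,3) Qc(2,3,5) Rc(2,3,5) rows
    by (simp add: dim_simps unitary_cancel[OF U(1)] unitary_cancel[OF U(2)] unitary_cancel[OF U(3)])
  obtain E F G where os: "orthogonal_sum cs (diag_pair cs) E F G"
    using diag_pair_orthogonal_sum w by blast
  have dr: "dim_row (snd (diag_pair cs)) = dim_row A" by (simp add: D Pc)
  have EI: "\<And>t. t < length cs \<Longrightarrow> intertwiner (cs ! t) (diag_pair cs) (E t) (F t) (G t)"
    and EE: "\<And>t. t < length cs \<Longrightarrow> mat_adjoint (E t) * E t = 1\<^sub>m (dim_row (snd (cs ! t)))"
    and EP: "\<And>X. dim_row X = dim_row A \<Longrightarrow> (\<Sum>t<length cs. frob_sq (mat_adjoint (E t) * X)) = frob_sq X"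
    using os by (auto simp: orthogonal_sum_def dr)
  note Ed = intertwinerD(1,2)[OF EI, unfolded dr]
  have "intertwiner (cs ! t) (B, A) (P * E t) (Q * F t) (R * G t)" if "t < length cs" for t
    using intertwiner_comp[OF _ wf_diag_pair[OF w] wy EI[OF that] I] w that by simp
  moreover have "mat_adjoint (P * E t) * (P * E t) = 1\<^sub>m (dim_row (snd (cs ! t)))"
    if t: "t < length cs" for t
    using Ed[OF t] Pc(2,3) EE[OF t] by (simp add: dim_simps unitary_cancel[OF U(1)])
  moreover have "(\<Sum>t<length cs. frob_sq (mat_adjoint (P * E t) * X)) = frob_sq X" if X: "dim_row X = dim_row A" for X
  proof -
    have "(\<Sum>t<length cs. frob_sq (mat_adjoint (P * E t) * X)) =
      (\<Sum>t<length cs. frob_sq (mat_adjoint (E t) * (mat_adjoint P * X)))"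
      using Ed Pc(2,3) X by (intro sum.cong) (auto simp: dim_simps)
    also have "\<dots> = frob_sq (mat_adjoint P * X)" using Pc by (intro EP) simp
    also have "\<dots> = frob_sq X"
      using Pc X by (intro frob_sq_isometry[of _ "dim_row A"]) auto
    finally show ?thesis .
  qed
  ultimately have "orthogonal_sum cs (B, A) (\<lambda>t. P * E t) (\<lambda>t. Q * F t) (\<lambda>t. R * G t)"
    unfolding orthogonal_sum_def by simp
  then show ?thesis by blast
qed

section \<open>Matching two irreducible orthogonal sums\<close>

text \<open>
  As \<open>w\<close> links only indices of the same class, the sum of \<open>w\<close> over the rows of a class is also its
  sum over the columns of that class. As the row and column sums are 1, these sums count the members
  of the class on either side.
\<close>
lemma stochastic_matching:
  fixes w :: "nat \<Rightarrow> nat \<Rightarrow> real"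
  assumes r: "\<And>i. i < g \<Longrightarrow> (\<Sum>j<h. w i j) = 1" and c: "\<And>j. j < h \<Longrightarrow> (\<Sum>i<g. w i j) = 1"
    and f: "\<And>i j. i < g \<Longrightarrow> j < h \<Longrightarrow> w i j \<noteq> 0 \<Longrightarrow> f i = f' j"
  shows "g = h \<and> (\<exists>\<pi>. \<pi> permutes {..<g} \<and> (\<forall>i<g. f i = f' (\<pi> i)))"
proof -
  have "real g = (\<Sum>i<g. \<Sum>j<h. w i j)" using r by simp
  also have "\<dots> = (\<Sum>j<h. \<Sum>i<g. w i j)" by (rule sum.swap)
  also have "\<dots> = real h" using c by simp
  finally have gh: "g = h" by simp
  have "card {i\<in>{..<g}. f i = x} = card {j\<in>{..<h}. f' j = x}" for x
  proof -
    have "real (card {i\<in>{..<g}. f i = x}) = (\<Sum>i<g. if f i = x then \<Sum>j<h. w i j else 0)"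
      using r by (simp add: sum.If_cases Int_def)
    also have "\<dots> = (\<Sum>i<g. \<Sum>j<h. if f i = x then w i j else 0)"
      by (intro sum.cong) auto
    also have "\<dots> = (\<Sum>i<g. \<Sum>j<h. if f' j = x then w i j else 0)"
      by (intro sum.cong refl) (use f in force)
    also have "\<dots> = (\<Sum>j<h. \<Sum>i<g. if f' j = x then w i j else 0)" by (rule sum.swap)
    also have "\<dots> = (\<Sum>j<h. if f' j = x then \<Sum>i<g. w i j else 0)"
      by (intro sum.cong) auto
    also have "\<dots> = real (card {j\<in>{..<h}. f' j = x})"
      using c by (simp add: sum.If_cases Int_def)
    finally show ?thesis by simp
  qed
  then have "image_mset f' (mset_set {..<g}) = image_mset f (mset_set {..<g})"
    unfolding gh by (intro multiset_eqI) (simp add: count_image_mset' eq_commute)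
  then obtain \<pi> where "\<pi> permutes {..<g}" "\<forall>i\<in>{..<g}. f i = f' (\<pi> i)"
    using image_mset_eq_implies_permutes[of "{..<g}" f f'] by auto
  then show ?thesis using gh by auto
qed

text \<open>
  The intertwiner \<open>(E' j)\<^sup>* E i\<close> from \<open>cs ! i\<close> to \<open>cs' ! j\<close> vanishes unless the two are equivalent.
  Parseval's identity for \<open>E'\<close>, applied to \<open>E i\<close>, and for \<open>E\<close>, applied to \<open>E' j\<close>, says that the
  squared norms of these maps, divided by the dimension of the row space, form a doubly stochastic
  matrix.
\<close>
lemma irreducible_orthogonal_sums_match:
  assumes y: "wf_pair y" and s: "orthogonal_sum cs y E F G" and s': "orthogonal_sum cs' y E' F' G'"
    and irr: "\<And>x. x \<in> set cs \<Longrightarrow> irreducible_core x" and irr': "\<And>x. x \<in> set cs' \<Longrightarrow> irreducible_core x"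
  shows "length cs = length cs' \<and> (\<exists>\<pi>. \<pi> permutes {..<length cs} \<and>
    (\<forall>t<length cs. unitarily_equiv (cs ! t) (cs' ! \<pi> t)))"
proof -
  define m where "m t = dim_row (snd (cs ! t))" for t
  define m' where "m' t = dim_row (snd (cs' ! t))" for t
  have x: "irreducible_core (cs ! t)" "wf_pair (cs ! t)" "0 < m t" if "t < length cs" for t
    using irr[of "cs ! t"] that by (auto simp: irreducible_core_def m_def)
  have x': "irreducible_core (cs' ! t)" "wf_pair (cs' ! t)" "0 < m' t" if "t < length cs'" for t
    using irr'[of "cs' ! t"] that by (auto simp: irreducible_core_def m'_def)
  have I: "\<And>t. t < length cs \<Longrightarrow> intertwiner (cs ! t) y (E t) (F t) (G t)"
    and N: "\<And>t. t < length cs \<Longrightarrow> mat_adjoint (E t) * E t = 1\<^sub>m (m t)"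
    and S: "\<And>X. dim_row X = dim_row (snd y) \<Longrightarrow> (\<Sum>t<length cs. frob_sq (mat_adjoint (E t) * X)) = frob_sq X"
    using s by (auto simp: orthogonal_sum_def m_def)
  have I': "\<And>t. t < length cs' \<Longrightarrow> intertwiner (cs' ! t) y (E' t) (F' t) (G' t)"
    and N': "\<And>t. t < length cs' \<Longrightarrow> mat_adjoint (E' t) * E' t = 1\<^sub>m (m' t)"
    and S': "\<And>X. dim_row X = dim_row (snd y) \<Longrightarrow> (\<Sum>t<length cs'. frob_sq (mat_adjoint (E' t) * X)) = frob_sq X"
    using s' by (auto simp: orthogonal_sum_def m'_def)
  note d = intertwinerD(1,2)[OF I, folded m_def] and d' = intertwinerD(1,2)[OF I', folded m'_def]
  have fE: "frob_sq (E t) = m t" if "t < length cs" for t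
  proof -
    have "complex_of_real (frob_sq (E t)) = of_nat (m t) * 1"
      using N[OF that] d[OF that] by (intro frob_sq_of_scalar_gram) auto
    then show ?thesis by (metis mult.right_neutral of_real_eq_iff of_real_of_nat_eq)
  qed
  have fE': "frob_sq (E' t) = m' t" if "t < length cs'" for t
  proof -
    have "complex_of_real (frob_sq (E' t)) = of_nat (m' t) * 1"
      using N'[OF that] d'[OF that] by (intro frob_sq_of_scalar_gram) auto
    then show ?thesis by (metis mult.right_neutral of_real_eq_iff of_real_of_nat_eq)
  qed
  define p where "p i j = mat_adjoint (E' j) * E i" for i j
  have pI: "intertwiner (cs ! i) (cs' ! j) (p i j) (mat_adjoint (F' j) * F i) (mat_adjoint (G' j) * G i)"
    if "i < length cs" "j < length cs'" for i j
    unfolding p_def using x x' that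
    by (intro intertwiner_comp[OF _ y _ I intertwiner_adjoint[OF _ y I']]) auto
  have pe: "unitarily_equiv (cs ! i) (cs' ! j) \<and> m i = m' j"
    if "i < length cs" "j < length cs'" "frob_sq (p i j) \<noteq> 0" for i j
    using nonzero_intertwiner_equiv[OF x(1)[OF that(1)] x'(1)[OF that(2)] pI[OF that(1,2)] that(3)]
    by (simp add: m_def m'_def)
  define w where "w i j = frob_sq (p i j) / m i" for i j
  \<comment> \<open>The same weight seen from \<open>cs'\<close>: where it is nonzero, the row dimensions agree.\<close>
  have w': "w i j = frob_sq (mat_adjoint (E i) * E' j) / m' j" if "i < length cs" "j < length cs'" for i j
  proof -
    have "mat_adjoint (p i j) = mat_adjoint (E i) * E' j"
      using d[OF that(1)] d'[OF that(2)] by (simp add: p_def mat_adjoint_mult_dim)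
    then have "frob_sq (mat_adjoint (E i) * E' j) = frob_sq (p i j)" by (metis frob_sq_adjoint)
    then show ?thesis using pe[OF that] by (cases "frob_sq (p i j) = 0") (auto simp: w_def)
  qed
  have r: "(\<Sum>j<length cs'. w i j) = 1" if "i < length cs" for i
    unfolding w_def p_def sum_divide_distrib[symmetric]
    using S'[of "E i"] fE[OF that] d[OF that] x(3)[OF that] by simp
  have c: "(\<Sum>i<length cs. w i j) = 1" if "j < length cs'" for j
  proof -
    have "(\<Sum>i<length cs. w i j) = (\<Sum>i<length cs. frob_sq (mat_adjoint (E i) * E' j)) / m' j"
      unfolding sum_divide_distrib using w' that by (intro sum.cong) auto
    then show ?thesis using S[of "E' j"] fE'[OF that] d'[OF that] x'(3)[OF that] by simp
  qed
  \<comment> \<open>Equivalent components have equal classes, so the matching can compare sets.\<close>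
  have cls: "{z. unitarily_equiv (cs ! i) z} = {z. unitarily_equiv (cs' ! j) z}"
    if "i < length cs" "j < length cs'" "w i j \<noteq> 0" for i j
  proof -
    have "unitarily_equiv (cs ! i) (cs' ! j)" using pe[OF that(1,2)] that(3) by (auto simp: w_def)
    then show ?thesis
      using x(2)[OF that(1)] x'(2)[OF that(2)] unitarily_equiv_sym unitarily_equiv_trans by blast
  qed
  have "length cs = length cs' \<and> (\<exists>\<pi>. \<pi> permutes {..<length cs} \<and> (\<forall>i<length cs.
      {z. unitarily_equiv (cs ! i) z} = {z. unitarily_equiv (cs' ! \<pi> i) z}))"
    by (rule stochastic_matching[where f = "\<lambda>i. {z. unitarily_equiv (cs ! i) z}"
          and f' = "\<lambda>j. {z. unitarily_equiv (cs' ! j) z}" and w = w])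
      (fact r c cls)+
  then obtain \<pi> where len: "length cs = length cs'" and \<pi>: "\<pi> permutes {..<length cs}"
    and eq: "\<And>i. i < length cs \<Longrightarrow>
      {z. unitarily_equiv (cs ! i) z} = {z. unitarily_equiv (cs' ! \<pi> i) z}"
    by blast
  have "unitarily_equiv (cs ! t) (cs' ! \<pi> t)" if "t < length cs" for t
    using eq[OF that] unitarily_equiv_refl[OF x'(2)[of "\<pi> t"]] permutes_lessThan[OF \<pi> that] len by auto
  then show ?thesis using len \<pi> by blast
qed

theorem theorem5p8:
  fixes B1 A11 P Q R P' Q' R' :: "complex mat"
    and cs cs' :: "(complex mat \<times> complex mat) list"
  assumes "core_problem B1 A11"
    and "irreducible_reduced_structure B1 A11 P Q R cs"
    and "irreducible_reduced_structure B1 A11 P' Q' R' cs'"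
  shows "length cs = length cs' \<and>
    (\<exists>\<pi>. \<pi> permutes {..<length cs} \<and>
      (\<forall>t<length cs. \<exists>Pt Qt Rt.
         unitary_mat (dim_row (snd (cs ! t))) Pt \<and>
         unitary_mat (dim_col (snd (cs ! t))) Qt \<and>
         unitary_mat (dim_col (fst (cs ! t))) Rt \<and>
         mat_adjoint Pt * fst (cs ! t) * Rt = fst (cs' ! \<pi> t) \<and>
         mat_adjoint Pt * snd (cs ! t) * Qt = snd (cs' ! \<pi> t)))"
proof -
  have rs: "reduced_structure B1 A11 P Q R cs" and rs': "reduced_structure B1 A11 P' Q' R' cs'"
    using assms(2,3) by (auto simp: irreducible_reduced_structure_def)
  have irr: "irreducible_core x" if "x \<in> set cs" for x
    using assms(2) that
    by (fastforce simp: irreducible_reduced_structure_def reduced_structure_def irreducible_core_def wf_pair_def)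
  have irr': "irreducible_core x" if "x \<in> set cs'" for x
    using assms(3) that
    by (fastforce simp: irreducible_reduced_structure_def reduced_structure_def irreducible_core_def wf_pair_def)
  obtain E F G where os: "orthogonal_sum cs (B1, A11) E F G"
    using reduced_structure_orthogonal_sum[OF rs] by blast
  obtain E' F' G' where os': "orthogonal_sum cs' (B1, A11) E' F' G'"
    using reduced_structure_orthogonal_sum[OF rs'] by blast
  have "wf_pair (B1, A11)" using rs by (simp add: reduced_structure_def wf_pair_def)
  from irreducible_orthogonal_sums_match[OF this os os' irr irr']
  show ?thesis unfolding unitarily_equiv_def .
qed

end
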